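(* Let $\mathrm{M}$ be a matroid on $[n]=\{1,\dots,n\}$ and let $\mathrm{N}$ be a matroid on $[m]=\{1,\dots,m\}$. For any morphism of matroids $f:\mathrm{M}\to\mathrm{N}$, the homogeneous basis generating polynomial $$\mathrm{B}_f(w_0,w_1,\ldots,w_n):=\sum_{S\in\mathscr{B}(f)}w_0^{\,n-|S|}\prod_{i\in S}w_i$$ is a Lorentzian polynomial.
   Context: A matroid $\mathrm{M}$ on a finite set $E$ is given by its rank function $\operatorname{rk}_{\mathrm{M}}:2^E\to\mathbb{N}$ (with $\operatorname{rk}_{\mathrm M}(S)\le|S|$, monotone, submodular). A basis of $\mathrm{M}$ is a subset $S$ with $\operatorname{rk}_{\mathrm M}(S)=|S|=\operatorname{rk}_{\mathrm M}(E)$. A morphism $f:\mathrm{M}\to\mathrm{N}$ between matroids $\mathrm{M}$ on $E$ and $\mathrm{N}$ on $F$ is a function $f:E\to F$ such that $\operatorname{rk}_{\mathrm{N}}(f(S_2))-\operatorname{rk}_{\mathrm{N}}(f(S_1))\le\operatorname{rk}_{\mathrm{M}}(S_2)-\operatorname{rk}_{\mathrm{M}}(S_1)$ for all $S_1\subseteq S_2\subseteq E$. A subset $S\subseteq E$ is a basis of $f$ if $S$ is contained in a basis of $\mathrm{M}$ and $f(S)$ contains a basis of $\mathrm{N}$; $\mathscr{B}(f)$ denotes the set of bases of $f$. Lorentzian polynomials: a homogeneous polynomial $h$ of degree $d$ with real coefficients in a finite set of variables $w_i$ is strictly Lorentzian if all of its coefficients (i.e. those of all degree-$d$ monomials in the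 variables) are positive and, for any indices $i_1,\ldots,i_{d-2}$, the quadratic form $\partial_{i_1}\cdots\partial_{i_{d-2}}h$ has the Lorentzian signature $(+,-,\ldots,-)$, where $\partial_i=\partial/\partial w_i$ (this second condition is vacuous when $d<2$). Lorentzian polynomials are the polynomials that can be obtained as a limit of strictly Lorentzian polynomials (of the same degree in the same variables); in particular the zero polynomial is Lorentzian. *)

theory Defs
  imports Complex_Main "HOL-Library.Poly_Mapping" "Jordan_Normal_Form.Matrix"
begin

section \<open>Matroids given by rank functions\<close>

definition matroid :: "'a set \<Rightarrow> ('a set \<Rightarrow> nat) \<Rightarrow> bool" where
  "matroid E rk \<longleftrightarrow>
     finite E \<and>
     (\<forall>S. S \<subseteq> E \<longrightarrow> rk S \<le> card S) \<and>
     (\<forall>S T. S \<subseteq> T \<and> T \<subseteq> E \<longrightarrow> rk S \<le> rk T) \<and>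
     (\<forall>S T. S \<subseteq> E \<and> T \<subseteq> E \<longrightarrow> rk (S \<union> T) + rk (S \<inter> T) \<le> rk S + rk T)"

definition matroid_basis :: "'a set \<Rightarrow> ('a set \<Rightarrow> nat) \<Rightarrow> 'a set \<Rightarrow> bool" where
  "matroid_basis E rk S \<longleftrightarrow> S \<subseteq> E \<and> rk S = card S \<and> card S = rk E"

text \<open>The rank differences are taken in the integers, since subtraction on \<^typ>\<open>nat\<close> truncates.\<close>

definition matroid_morphism ::
  "'a set \<Rightarrow> ('a set \<Rightarrow> nat) \<Rightarrow> 'b set \<Rightarrow> ('b set \<Rightarrow> nat) \<Rightarrow> ('a \<Rightarrow> 'b) \<Rightarrow> bool" where
  "matroid_morphism E rkM F rkN f \<longleftrightarrow>
     matroid E rkM \<and> matroid F rkN \<and> f ` E \<subseteq> F \<and>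
     (\<forall>S1 S2. S1 \<subseteq> S2 \<and> S2 \<subseteq> E \<longrightarrow>
        int (rkN (f ` S2)) - int (rkN (f ` S1)) \<le> int (rkM S2) - int (rkM S1))"

definition morphism_bases ::
  "'a set \<Rightarrow> ('a set \<Rightarrow> nat) \<Rightarrow> 'b set \<Rightarrow> ('b set \<Rightarrow> nat) \<Rightarrow> ('a \<Rightarrow> 'b) \<Rightarrow> 'a set set" where
  "morphism_bases E rkM F rkN f =
     {S. S \<subseteq> E \<and> (\<exists>B. matroid_basis E rkM B \<and> S \<subseteq> B) \<and>
                (\<exists>C. matroid_basis F rkN C \<and> C \<subseteq> f ` S)}"


section \<open>Real polynomials in the variables $w_0, w_1, \ldots$\<close>

text \<open>
  A monomial is its finitely supported exponent vector, and a polynomial maps monomials to their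
  coefficients; the ring structure (convolution product) is the one of
  \<^theory>\<open>HOL-Library.Poly_Mapping\<close>.
\<close>

type_synonym monom = "nat \<Rightarrow>\<^sub>0 nat"
type_synonym rpoly = "monom \<Rightarrow>\<^sub>0 real"

definition var :: "nat \<Rightarrow> rpoly" where
  "var i = Poly_Mapping.single (Poly_Mapping.single i 1) 1"

definition monoms_of :: "nat \<Rightarrow> nat \<Rightarrow> monom set" where
  "monoms_of N d =
     {\<alpha>. Poly_Mapping.keys \<alpha> \<subseteq> {..<N} \<and> (\<Sum>i<N. Poly_Mapping.lookup \<alpha> i) = d}"

definition homogeneous :: "nat \<Rightarrow> nat \<Rightarrow> rpoly \<Rightarrow> bool" where
  "homogeneous N d h \<longleftrightarrow> Poly_Mapping.keys h \<subseteq> monoms_of N d"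

text \<open>
  If the exponent of \<open>w\<^sub>i\<close> in \<open>\<alpha>\<close> is \<open>0\<close>, then the truncated difference of exponents is
  harmless, because the coefficient vanishes.
\<close>

definition partial_deriv :: "nat \<Rightarrow> rpoly \<Rightarrow> rpoly" where
  "partial_deriv i h =
     (\<Sum>\<alpha>\<in>Poly_Mapping.keys h.
        Poly_Mapping.single (\<alpha> - Poly_Mapping.single i 1)
          (real (Poly_Mapping.lookup \<alpha> i) * Poly_Mapping.lookup h \<alpha>))"

lemma lookup_partial_deriv:
  "Poly_Mapping.lookup (partial_deriv i h) \<beta> =
     real (Poly_Mapping.lookup \<beta> i + 1) * Poly_Mapping.lookup h (\<beta> + Poly_Mapping.single i 1)"
proof -
  let ?e = "Poly_Mapping.single i (1::nat)"
  let ?t = "\<lambda>\<alpha>. real (Poly_Mapping.lookup \<alpha> i) * Poly_Mapping.lookup h \<alpha>"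
  have iff: "\<alpha> - ?e = \<beta> \<longleftrightarrow> \<alpha> = \<beta> + ?e" if "Poly_Mapping.lookup \<alpha> i \<noteq> 0" for \<alpha> :: monom
  proof
    assume \<beta>: "\<alpha> - ?e = \<beta>"
    show "\<alpha> = \<beta> + ?e"
    proof (rule poly_mapping_eqI)
      fix k
      show "Poly_Mapping.lookup \<alpha> k = Poly_Mapping.lookup (\<beta> + ?e) k"
        unfolding \<beta>[symmetric] lookup_add lookup_minus lookup_single
        using that by (cases "i = k") simp_all
    qed
  qed simp
  have "Poly_Mapping.lookup (partial_deriv i h) \<beta> =
      (\<Sum>\<alpha>\<in>Poly_Mapping.keys h. ?t \<alpha> when \<alpha> - ?e = \<beta>)"
    by (simp add: partial_deriv_def lookup_sum lookup_single)
  also have "\<dots> = (\<Sum>\<alpha>\<in>Poly_Mapping.keys h. if \<alpha> = \<beta> + ?e then ?t \<alpha> else 0)"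
  proof (rule sum.cong[OF refl])
    fix \<alpha> :: monom
    show "(?t \<alpha> when \<alpha> - ?e = \<beta>) = (if \<alpha> = \<beta> + ?e then ?t \<alpha> else 0)"
    proof (cases "Poly_Mapping.lookup \<alpha> i = 0")
      case True
      then have "?t \<alpha> = 0" by simp
      then show ?thesis by (metis when_def)
    next
      case False
      show ?thesis unfolding when_def iff[OF False] ..
    qed
  qed
  also have "\<dots> = ?t (\<beta> + ?e)"
    by (simp add: in_keys_iff)
  finally show ?thesis
    by (simp add: lookup_add)
qed


section \<open>Signature of a quadratic form\<close>

text \<open>The symmetric matrix \<open>A\<close> with \<open>q(w) = w\<^sup>T A w\<close>, for a quadratic form \<open>q\<close> in \<open>N\<close> variables.\<close>

definition quad_form_mat :: "nat \<Rightarrow> rpoly \<Rightarrow> real mat" where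
  "quad_form_mat N q = Matrix.mat N N (\<lambda>(i, j).
     let c = Poly_Mapping.lookup q (Poly_Mapping.single i 1 + Poly_Mapping.single j 1)
     in if i = j then c else c / 2)"

text \<open>
  Some linear change of coordinates turns the form into a diagonal one with \<open>p\<close> positive and \<open>r\<close>
  negative entries; by Sylvester's law of inertia, \<open>p\<close> and \<open>r\<close> are determined by the form.
\<close>

definition has_signature :: "nat \<Rightarrow> rpoly \<Rightarrow> nat \<Rightarrow> nat \<Rightarrow> bool" where
  "has_signature N q p r \<longleftrightarrow>
     (\<exists>P D. P \<in> carrier_mat N N \<and> invertible_mat P \<and>
            transpose_mat P * quad_form_mat N q * P = mat_diag N D \<and>
            card {i. i < N \<and> D i > 0} = p \<and> card {i. i < N \<and> D i < 0} = r)"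


section \<open>Lorentzian polynomials\<close>

text \<open>
  The derivative condition has \<open>d - 2\<close> indices (repetitions allowed), so it is vacuous for
  \<open>d < 2\<close>.
\<close>

definition strictly_lorentzian :: "nat \<Rightarrow> nat \<Rightarrow> rpoly \<Rightarrow> bool" where
  "strictly_lorentzian N d h \<longleftrightarrow>
     homogeneous N d h \<and>
     (\<forall>\<alpha>\<in>monoms_of N d. Poly_Mapping.lookup h \<alpha> > 0) \<and>
     (\<forall>is. length is + 2 = d \<and> set is \<subseteq> {..<N} \<longrightarrow>
        has_signature N (foldr partial_deriv is h) 1 (N - 1))"

text \<open>
  The limit is taken in the finite-dimensional space of homogeneous polynomials of degree \<open>d\<close> in
  \<open>N\<close> variables, where convergence means convergence of all coefficients.
\<close>

definition lorentzian :: "nat \<Rightarrow> nat \<Rightarrow> rpoly \<Rightarrow> bool" where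
  "lorentzian N d h \<longleftrightarrow>
     homogeneous N d h \<and>
     (\<exists>g. (\<forall>k. strictly_lorentzian N d (g k)) \<and>
          (\<forall>\<alpha>. (\<lambda>k::nat. Poly_Mapping.lookup (g k) \<alpha>) \<longlonglongrightarrow> Poly_Mapping.lookup h \<alpha>))"


section \<open>The homogeneous basis generating polynomial\<close>

definition basis_gen_poly ::
  "nat \<Rightarrow> (nat set \<Rightarrow> nat) \<Rightarrow> nat \<Rightarrow> (nat set \<Rightarrow> nat) \<Rightarrow> (nat \<Rightarrow> nat) \<Rightarrow> rpoly" where
  "basis_gen_poly n rkM m rkN f =
     (\<Sum>S\<in>morphism_bases {1..n} rkM {1..m} rkN f. var 0 ^ (n - card S) * (\<Prod>i\<in>S. var i))"

end

theory Submission
  imports Defs "Jordan_Normal_Form.Determinant"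
begin

text \<open>
  The basis generating polynomial is a limit of polynomials in which every subset \<open>S\<close> of the
  ground set, not only every basis, has a positive weight. Write \<open>r\<close> for the rank function of
  the source and \<open>s S\<close> for the rank of \<open>f ` S\<close> in the target. Give \<open>S\<close> the weight
  \<open>p\<^bsup>card S - r S\<^esup> q\<^bsup>R - s S\<^esup>\<close>, with \<open>R\<close> the rank of the target. As \<open>p\<close> and \<open>q\<close> tend to \<open>0\<close>,
  this becomes the indicator of \<open>S\<close> being independent with spanning image, that is, of being a
  basis of \<open>f\<close> (\<open>morphism_bases_iff\<close>). An extra factor \<open>t\<^bsup>(card S)\<^sup>2\<^esup>\<close> with \<open>t < 1\<close> makes all
  inequalities strict.

  Differentiating in the variables of a set \<open>T\<close> contracts \<open>T\<close>, and differentiating further in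
  \<open>w\<^sub>0\<close> leaves a quadratic form. That it has Lorentzian signature is a statement about pairs of
  elements of the contraction. The ratios of neighbouring weights depend only on which pairs are
  parallel in the source and in the target, and they are convex combinations of the indicators
  of being unrelated under four equivalence relations, for each of which the inequality is
  Cauchy-Schwarz for the class sums (\<open>quotient_pairs_strict\<close>, \<open>quotient_weight_log_concave\<close>).

  From these coordinate derivatives one passes to derivatives in arbitrary strictly positive
  directions by induction on the degree. The step (\<open>lorentz_form_of_slices\<close>) is a Bochner type
  argument: if the Hessians of all partial derivatives satisfy a reverse Cauchy-Schwarz
  inequality, then so does the Hessian of a positive combination of them. The outcome is
  \<open>lorentz_form_dird\<close>.

  Finally, substituting for the variables strictly positive linear forms close to them makes all
  coefficients positive and turns the coordinate derivatives into derivatives in positive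
  directions. The resulting polynomials are strictly Lorentzian (\<open>strictly_lorentzian_perturb\<close>),
  and they converge to the basis generating polynomial.
\<close>

section \<open>Lorentzian bilinear forms\<close>

definition bil :: "nat set \<Rightarrow> (nat \<Rightarrow> nat \<Rightarrow> real) \<Rightarrow> (nat \<Rightarrow> real) \<Rightarrow> (nat \<Rightarrow> real) \<Rightarrow> real" where
  "bil V a x y = (\<Sum>j\<in>V. \<Sum>k\<in>V. a j k * x j * y k)"

lemma bil_sum_rows: "bil V a x y = (\<Sum>j\<in>V. x j * (\<Sum>k\<in>V. a j k * y k))"
  by (simp add: bil_def sum_distrib_left algebra_simps)

lemma bil_add_left: "bil V a (\<lambda>i. x i + y i) z = bil V a x z + bil V a y z"
  by (simp add: bil_def algebra_simps sum.distrib)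

lemma bil_add_right: "bil V a z (\<lambda>i. x i + y i) = bil V a z x + bil V a z y"
  by (simp add: bil_def algebra_simps sum.distrib)

lemma bil_scale_left: "bil V a (\<lambda>i. s * x i) z = s * bil V a x z"
  by (simp add: bil_def sum_distrib_left algebra_simps)

lemma bil_scale_right: "bil V a z (\<lambda>i. s * x i) = s * bil V a z x"
  by (simp add: bil_def sum_distrib_left algebra_simps)

lemma bil_cong:
  "\<lbrakk>\<And>i. i \<in> V \<Longrightarrow> x i = x' i; \<And>i. i \<in> V \<Longrightarrow> y i = y' i\<rbrakk> \<Longrightarrow> bil V a x y = bil V a x' y'"
  by (simp add: bil_def)

lemma bil_commute:
  assumes "\<And>j k. \<lbrakk>j \<in> V; k \<in> V\<rbrakk> \<Longrightarrow> a j k = a k j"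
  shows "bil V a x y = bil V a y x"
  unfolding bil_def by (subst sum.swap) (auto intro!: sum.cong simp: assms)

text \<open>
  Negative definiteness is only asked on the complement of one vector, which is what the
  constructions below deliver; the complement of every vector with positive square then shares
  it (\<open>lorentz_form_negative\<close>). No basis or diagonalization enters, so the index set may be any
  subset of the naturals, and it will shrink when elements are contracted.
\<close>
definition lorentz_form :: "nat set \<Rightarrow> (nat \<Rightarrow> nat \<Rightarrow> real) \<Rightarrow> bool" where
  "lorentz_form V a \<longleftrightarrow> (\<forall>j\<in>V. \<forall>k\<in>V. a j k = a k j) \<and>
     (\<exists>u. bil V a u u > 0 \<and>
       (\<forall>x. bil V a x u = 0 \<and> (\<exists>i\<in>V. x i \<noteq> 0) \<longrightarrow> bil V a x x < 0))"

lemma lorentz_form_commute: "lorentz_form V a \<Longrightarrow> bil V a x y = bil V a y x"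
  unfolding lorentz_form_def by (intro bil_commute) auto

text \<open>
  A vector \<open>x\<close> orthogonal to \<open>v\<close> with nonnegative square would span, together with \<open>v\<close>, a plane
  on which the form is nonnegative. That plane meets the hyperplane orthogonal to \<open>u\<close>, where the
  form is negative.
\<close>
lemma lorentz_form_negative:
  assumes L: "lorentz_form V a" and v: "bil V a v v > 0"
    and xv: "bil V a x v = 0" and x: "\<exists>i\<in>V. x i \<noteq> 0"
  shows "bil V a x x < 0"
proof (rule ccontr)
  assume xx: "\<not> bil V a x x < 0"
  obtain u where neg: "\<And>x. \<lbrakk>bil V a x u = 0; \<exists>i\<in>V. x i \<noteq> 0\<rbrakk> \<Longrightarrow> bil V a x x < 0"
    using L unfolding lorentz_form_def by blast
  note comm = lorentz_form_commute[OF L]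
  have v0: "\<exists>i\<in>V. v i \<noteq> 0"
  proof (rule ccontr)
    assume "\<not> (\<exists>i\<in>V. v i \<noteq> 0)"
    then have "bil V a v v = 0" by (simp add: bil_def)
    with v show False by simp
  qed
  have s: "bil V a v u \<noteq> 0" using neg[OF _ v0] v by fastforce
  define z where "z = (\<lambda>i. bil V a v u * x i + (- bil V a x u) * v i)"
  have zu: "bil V a z u = 0"
    unfolding z_def bil_add_left bil_scale_left by simp
  have zz: "bil V a z z = (bil V a v u)\<^sup>2 * bil V a x x + (bil V a x u)\<^sup>2 * bil V a v v"
    unfolding z_def bil_add_left bil_scale_left bil_add_right bil_scale_right
    using xv comm[of v x] by (simp add: power2_eq_square)
  have "bil V a z z \<ge> 0" unfolding zz using xx v by simp
  then have z0: "z i = 0" if "i \<in> V" for i using neg[OF zu] that by fastforce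
  have "bil V a z v = - bil V a x u * bil V a v v"
    unfolding z_def bil_add_left bil_scale_left using xv by simp
  moreover have "bil V a z v = 0" using z0 by (simp add: bil_def)
  ultimately have "bil V a x u = 0" using v by simp
  then have "x i = 0" if "i \<in> V" for i using z0[OF that] s by (simp add: z_def)
  with x show False by blast
qed

text \<open>
  Project \<open>x\<close> along \<open>v\<close> onto the complement of \<open>v\<close>. The square of the projection is the left
  hand side minus the right hand side, divided by \<open>bil V a v v\<close>, and it is negative unless the
  projection is zero.
\<close>
lemma reverse_cauchy_schwarz:
  assumes L: "lorentz_form V a" and v: "bil V a v v > 0"
  shows "bil V a x x * bil V a v v \<le> (bil V a x v)\<^sup>2"
    and "\<forall>s. \<exists>i\<in>V. x i \<noteq> s * v i \<Longrightarrow> bil V a x x * bil V a v v < (bil V a x v)\<^sup>2"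
proof -
  note comm = lorentz_form_commute[OF L]
  define s where "s = bil V a x v / bil V a v v"
  define z where "z = (\<lambda>i. x i + (- s) * v i)"
  have zv: "bil V a z v = 0"
    unfolding z_def bil_add_left bil_scale_left using v by (simp add: s_def)
  have "bil V a z z = bil V a x x - s * bil V a x v"
    using zv comm[of x z] unfolding z_def bil_add_right bil_scale_right
    using comm[of x v] by (simp add: bil_add_left bil_scale_left algebra_simps)
  then have zz: "bil V a z z * bil V a v v = bil V a x x * bil V a v v - (bil V a x v)\<^sup>2"
    using v by (simp add: s_def field_simps power2_eq_square)
  show "bil V a x x * bil V a v v < (bil V a x v)\<^sup>2" if "\<forall>s. \<exists>i\<in>V. x i \<noteq> s * v i"
  proof -
    have "\<exists>i\<in>V. z i \<noteq> 0" using that[rule_format, of s] by (auto simp: z_def)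
    then have "bil V a z z < 0" by (rule lorentz_form_negative[OF L v zv])
    then have "bil V a z z * bil V a v v < 0" using v by (rule mult_neg_pos)
    then show ?thesis using zz by simp
  qed
  then show "bil V a x x * bil V a v v \<le> (bil V a x v)\<^sup>2"
  proof (cases "\<exists>i\<in>V. z i \<noteq> 0")
    case True
    then have "bil V a z z < 0" by (rule lorentz_form_negative[OF L v zv])
    then have "bil V a z z * bil V a v v < 0" using v by (rule mult_neg_pos)
    then show ?thesis using zz by simp
  next
    case False
    then have "bil V a z z = 0" by (simp add: bil_def)
    then show ?thesis using zz by simp
  qed
qed

text \<open>
  Gaussian elimination: after eliminating the variable \<open>a\<close>, the Schur complement of the pivot is
  again positive definite, since its value at \<open>z\<close> is the value of the original form at the
  extension of \<open>z\<close> that minimizes it.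
\<close>
lemma positive_definite_solvable:
  assumes "finite V"
    and "\<And>j k. \<lbrakk>j \<in> V; k \<in> V\<rbrakk> \<Longrightarrow> m j k = m k j"
    and "\<And>z. \<exists>i\<in>V. z i \<noteq> 0 \<Longrightarrow> bil V m z z > 0"
  shows "\<exists>y. \<forall>i\<in>V. (\<Sum>k\<in>V. m i k * y k) = x i"
  using assms
proof (induction V arbitrary: m x rule: finite_induct)
  case empty
  then show ?case by simp
next
  case (insert a W)
  note sym = insert.prems(1) and pos = insert.prems(2)
  have exp: "bil (insert a W) m z z
      = m a a * (z a)\<^sup>2 + 2 * z a * (\<Sum>k\<in>W. m a k * z k) + bil W m z z" for z
  proof -
    have "(\<Sum>j\<in>W. m j a * z j * z a) = z a * (\<Sum>k\<in>W. m a k * z k)"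
      unfolding sum_distrib_left using sym by (intro sum.cong) auto
    moreover have "(\<Sum>k\<in>W. m a k * z a * z k) = z a * (\<Sum>k\<in>W. m a k * z k)"
      unfolding sum_distrib_left by (intro sum.cong) auto
    ultimately show ?thesis
      using insert.hyps by (simp add: bil_def sum.distrib power2_eq_square)
  qed
  have maa: "m a a > 0"
  proof -
    have "bil (insert a W) m (\<lambda>i. if i = a then 1 else 0) (\<lambda>i. if i = a then 1 else 0) > 0"
      by (rule pos) auto
    moreover have "(\<Sum>k\<in>W. m a k * (if k = a then 1 else 0)) = 0"
      using insert.hyps by (intro sum.neutral) auto
    moreover have "bil W m (\<lambda>i. if i = a then 1 else 0) (\<lambda>i. if i = a then 1 else 0) = 0"
      unfolding bil_def using insert.hyps by (intro sum.neutral ballI) auto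
    ultimately show ?thesis unfolding exp by simp
  qed
  define m' where "m' = (\<lambda>i k. m i k - m i a * m a k / m a a)"
  have "\<exists>y. \<forall>i\<in>W. (\<Sum>k\<in>W. m' i k * y k) = x i - m i a * x a / m a a"
  proof (rule insert.IH)
    show "m' j k = m' k j" if "j \<in> W" "k \<in> W" for j k
      using that sym[of j k] sym[of j a] sym[of k a] by (simp add: m'_def)
    show "bil W m' z z > 0" if "\<exists>i\<in>W. z i \<noteq> 0" for z
    proof -
      define t where "t = (\<Sum>k\<in>W. m a k * z k)"
      define z' where "z' = z(a := - t / m a a)"
      have z': "z' i = z i" if "i \<in> W" for i using that insert.hyps by (auto simp: z'_def)
      have "bil (insert a W) m z' z' > 0" using that z' by (intro pos) auto
      moreover have "bil W m z' z' = bil W m z z" by (rule bil_cong) (auto simp: z')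
      moreover have "(\<Sum>k\<in>W. m a k * z' k) = t" by (simp add: z' t_def)
      moreover have "z' a = - t / m a a" by (simp add: z'_def)
      ultimately have "m a a * (t / m a a)\<^sup>2 - 2 * (t / m a a) * t + bil W m z z > 0"
        unfolding exp by simp
      then have p: "bil W m z z - t\<^sup>2 / m a a > 0"
        using maa by (simp add: power2_eq_square field_simps)
      have "bil W m' z z = bil W m z z - (\<Sum>j\<in>W. \<Sum>k\<in>W. (m j a * z j) * (m a k * z k) / m a a)"
        by (simp add: bil_def m'_def algebra_simps sum_subtractf)
      also have "(\<Sum>j\<in>W. \<Sum>k\<in>W. (m j a * z j) * (m a k * z k) / m a a)
          = (\<Sum>j\<in>W. m j a * z j) * t / m a a"
        by (simp add: t_def sum_product sum_divide_distrib)
      also have "(\<Sum>j\<in>W. m j a * z j) = t"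
        unfolding t_def using sym by (intro sum.cong) auto
      finally show ?thesis using p by (simp add: power2_eq_square)
    qed
  qed
  then obtain y where y: "\<And>i. i \<in> W \<Longrightarrow> (\<Sum>k\<in>W. m' i k * y k) = x i - m i a * x a / m a a"
    by blast
  define t where "t = (\<Sum>k\<in>W. m a k * y k)"
  define y' where "y' = y(a := (x a - t) / m a a)"
  have y': "y' i = y i" if "i \<in> W" for i using that insert.hyps by (auto simp: y'_def)
  have y'a: "y' a = (x a - t) / m a a" by (simp add: y'_def)
  show ?case
  proof (intro exI[of _ y'] ballI)
    fix i assume i: "i \<in> insert a W"
    have full: "(\<Sum>k\<in>insert a W. m i k * y' k) = m i a * y' a + (\<Sum>k\<in>W. m i k * y k)"
      using insert.hyps y' by simp
    show "(\<Sum>k\<in>insert a W. m i k * y' k) = x i"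
    proof (cases "i = a")
      case True
      then show ?thesis unfolding full y'a using maa by (simp add: t_def)
    next
      case False
      then have "(\<Sum>k\<in>W. m i k * y k) - m i a * t / m a a = x i - m i a * x a / m a a"
        using y[of i] i
        by (simp add: m'_def t_def algebra_simps sum_subtractf sum_distrib_left sum_divide_distrib)
      then show ?thesis unfolding full y'a using maa by (simp add: field_simps)
    qed
  qed
qed

section \<open>Positive combinations of Lorentzian slices\<close>

text \<open>
  This is the inductive engine, a discrete Bochner argument. Think of \<open>b\<close> as the third
  derivatives of a cubic form, of the slices \<open>b i\<close> as the Hessians of its partial derivatives,
  and of \<open>B\<close> as the Hessian of its derivative along \<open>v\<close>. Rescale by the diagonal matrix \<open>D\<close> with
  \<open>D v = B v\<close>, so that \<open>A = D\<^sup>-\<^sup>1 B\<close> is self-adjoint for the inner product of \<open>D\<close> and fixes \<open>v\<close>.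
  Summing the reverse Cauchy-Schwarz inequalities of the slices gives \<open>A\<^sup>2 \<ge> A\<close>, so every
  eigenvalue is \<open>\<le> 0\<close> or \<open>\<ge> 1\<close>; on the other hand \<open>L = D - B\<close> is the Laplacian of a connected
  weighted graph, whence \<open>A \<le> 1\<close> with equality only along \<open>v\<close>. So \<open>A \<le> 0\<close> on the complement of
  \<open>v\<close>, and the slice \<open>o'\<close> with a strict inequality excludes the eigenvalue \<open>0\<close>.

  Eigenvectors are avoided: for \<open>x\<close> orthogonal to \<open>v\<close> one solves \<open>L y = D x\<close> and compares \<open>x\<close>
  and \<open>y\<close> by the Cauchy-Schwarz inequality for \<open>L\<close>.
\<close>
lemma lorentz_form_of_slices:
  fixes V :: "nat set" and b :: "nat \<Rightarrow> nat \<Rightarrow> nat \<Rightarrow> real" and v :: "nat \<Rightarrow> real"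
  defines "B \<equiv> (\<lambda>j k. \<Sum>i\<in>V. v i * b i j k)"
  assumes fin: "finite V" and o: "o' \<in> V"
    and v: "\<And>i. i \<in> V \<Longrightarrow> v i > 0"
    and sym12: "\<And>i j k. \<lbrakk>i \<in> V; j \<in> V; k \<in> V\<rbrakk> \<Longrightarrow> b i j k = b j i k"
    and sym23: "\<And>i j k. \<lbrakk>i \<in> V; j \<in> V; k \<in> V\<rbrakk> \<Longrightarrow> b i j k = b i k j"
    and pos: "\<And>i. i \<in> V \<Longrightarrow> bil V (b i) v v > 0"
    and rcs: "\<And>i x. i \<in> V \<Longrightarrow> bil V (b i) x x * bil V (b i) v v \<le> (bil V (b i) x v)\<^sup>2"
    and strict: "\<And>x. \<forall>s. \<exists>i\<in>V. x i \<noteq> s * v i \<Longrightarrow>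
        bil V (b o') x x * bil V (b o') v v < (bil V (b o') x v)\<^sup>2"
    and nonneg: "\<And>j k. \<lbrakk>j \<in> V; k \<in> V\<rbrakk> \<Longrightarrow> B j k \<ge> 0"
    and star: "\<And>k. k \<in> V \<Longrightarrow> B o' k > 0"
  shows "lorentz_form V B"
proof -
  have symB: "B j k = B k j" if "j \<in> V" "k \<in> V" for j k
    unfolding B_def using that by (intro sum.cong refl arg_cong2[where f="(*)"] sym23)
  note comm = bil_commute[of V B, OF symB]
  have B_sum: "bil V B x y = (\<Sum>i\<in>V. v i * bil V (b i) x y)" for x y
  proof -
    have "bil V B x y = (\<Sum>j\<in>V. \<Sum>k\<in>V. \<Sum>i\<in>V. v i * (b i j k * x j * y k))"
      by (simp add: bil_def B_def sum_distrib_left sum_distrib_right ac_simps)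
    also have "\<dots> = (\<Sum>j\<in>V. \<Sum>i\<in>V. \<Sum>k\<in>V. v i * (b i j k * x j * y k))"
      by (intro sum.cong refl sum.swap)
    also have "\<dots> = (\<Sum>i\<in>V. \<Sum>j\<in>V. \<Sum>k\<in>V. v i * (b i j k * x j * y k))"
      by (rule sum.swap)
    finally show ?thesis by (simp add: bil_def sum_distrib_left)
  qed
  \<comment> \<open>Total symmetry of \<open>b\<close>: the rows of \<open>B\<close> are the slices paired with \<open>v\<close>.\<close>
  have row: "(\<Sum>k\<in>V. B i k * y k) = bil V (b i) y v" if i: "i \<in> V" for i y
  proof -
    have "(\<Sum>k\<in>V. B i k * y k) = (\<Sum>k\<in>V. \<Sum>j\<in>V. b j i k * v j * y k)"
      by (simp add: B_def sum_distrib_right sum_distrib_left ac_simps)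
    also have "\<dots> = (\<Sum>k\<in>V. \<Sum>j\<in>V. b i k j * y k * v j)"
    proof (intro sum.cong refl)
      fix j k assume "k \<in> V" "j \<in> V"
      then show "b j i k * v j * y k = b i k j * y k * v j"
        using i sym12[of j i k] sym23[of i j k] by simp
    qed
    finally show ?thesis by (simp add: bil_def)
  qed
  define D where "D = (\<lambda>i. bil V (b i) v v / v i)"
  have Dpos: "D i > 0" if "i \<in> V" for i using pos[OF that] v[OF that] by (simp add: D_def)
  have Dv: "D i * v i = (\<Sum>k\<in>V. B i k * v k)" if "i \<in> V" for i
    using v[OF that] row[OF that, of v] by (simp add: D_def)
  define ip where "ip = (\<lambda>x y. \<Sum>i\<in>V. D i * x i * y i)"
  have ip_v: "ip x v = bil V B x v" for x
    unfolding ip_def bil_sum_rows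
  proof (intro sum.cong refl)
    fix i assume "i \<in> V"
    then show "D i * x i * v i = x i * (\<Sum>k\<in>V. B i k * v k)"
      using Dv[of i] by (simp add: algebra_simps)
  qed
  have ip_pos: "ip x x > 0" if x: "\<exists>i\<in>V. x i \<noteq> 0" for x
  proof -
    obtain i where i: "i \<in> V" "x i \<noteq> 0" using x by blast
    show ?thesis unfolding ip_def
    proof (rule sum_pos2[OF fin i(1)])
      show "0 < D i * x i * x i"
        using Dpos[OF i(1)] i(2) by (auto simp: mult.assoc zero_less_mult_iff linorder_neq_iff)
      show "\<And>i. i \<in> V \<Longrightarrow> 0 \<le> D i * x i * x i"
        using Dpos by (simp add: mult.assoc less_imp_le)
    qed
  qed
  define L where "L = (\<lambda>x y. ip x y - bil V B x y)"
  \<comment> \<open>The edge weights of the graph are \<open>B i j * v i * v j\<close>.\<close>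
  have L_sq: "2 * L z z = (\<Sum>i\<in>V. \<Sum>j\<in>V. B i j * v i * v j * (z i / v i - z j / v j)\<^sup>2)" for z
  proof -
    have "B i j * v i * v j * (z i / v i - z j / v j)\<^sup>2
        = (B i j * v j) * ((z i)\<^sup>2 / v i) + (B i j * v i) * ((z j)\<^sup>2 / v j) - 2 * (B i j * z i * z j)"
      if "i \<in> V" "j \<in> V" for i j
      using v[OF that(1)] v[OF that(2)] by (simp add: field_simps power2_eq_square)
    then have "(\<Sum>i\<in>V. \<Sum>j\<in>V. B i j * v i * v j * (z i / v i - z j / v j)\<^sup>2)
      = (\<Sum>i\<in>V. \<Sum>j\<in>V. (B i j * v j) * ((z i)\<^sup>2 / v i))
        + (\<Sum>i\<in>V. \<Sum>j\<in>V. (B i j * v i) * ((z j)\<^sup>2 / v j)) - 2 * bil V B z z"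
      by (simp add: sum.distrib sum_subtractf bil_def sum_distrib_left)
    moreover have "(\<Sum>i\<in>V. \<Sum>j\<in>V. (B i j * v j) * ((z i)\<^sup>2 / v i)) = ip z z"
      unfolding ip_def
    proof (intro sum.cong refl)
      fix i assume i: "i \<in> V"
      have "(\<Sum>j\<in>V. (B i j * v j) * ((z i)\<^sup>2 / v i)) = (D i * v i) * ((z i)\<^sup>2 / v i)"
        by (simp only: Dv[OF i] sum_distrib_right)
      then show "(\<Sum>j\<in>V. (B i j * v j) * ((z i)\<^sup>2 / v i)) = D i * z i * z i"
        using v[OF i] by (simp add: power2_eq_square)
    qed
    moreover have "(\<Sum>i\<in>V. \<Sum>j\<in>V. (B i j * v i) * ((z j)\<^sup>2 / v j))
        = (\<Sum>i\<in>V. \<Sum>j\<in>V. (B i j * v j) * ((z i)\<^sup>2 / v i))"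
      by (subst sum.swap) (auto intro!: sum.cong simp: symB)
    ultimately show ?thesis by (simp add: L_def)
  qed
  have L_nonneg: "L z z \<ge> 0" for z
  proof -
    have "2 * L z z \<ge> 0" unfolding L_sq
      using nonneg v by (intro sum_nonneg mult_nonneg_nonneg) (auto simp: less_imp_le)
    then show ?thesis by simp
  qed
  have L_zero: "z k = (z o' / v o') * v k" if z: "L z z = 0" and k: "k \<in> V" for z k
  proof -
    let ?f = "\<lambda>i j. B i j * v i * v j * (z i / v i - z j / v j)\<^sup>2"
    have nn: "?f i j \<ge> 0" if "i \<in> V" "j \<in> V" for i j
      using that nonneg v by (intro mult_nonneg_nonneg) (auto simp: less_imp_le)
    have "(\<Sum>j\<in>V. ?f o' j) = 0"
    proof (rule sum_nonneg_0[OF fin _ _ o])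
      show "(\<Sum>i\<in>V. \<Sum>j\<in>V. ?f i j) = 0" using L_sq[of z] z by simp
    qed (use nn in \<open>auto intro: sum_nonneg\<close>)
    then have "?f o' k = 0" by (rule sum_nonneg_0[OF fin _ _ k, rotated]) (use nn o in auto)
    then show ?thesis using star[OF k] v[OF k] v[OF o] by (simp add: field_simps)
  qed
  have L_add_left: "L (\<lambda>i. s * x i + r * y i) z = s * L x z + r * L y z" for s r x y z
    unfolding L_def bil_add_left bil_scale_left
    by (simp add: ip_def algebra_simps sum.distrib sum_distrib_left)
  have ip_comm: "ip x y = ip y x" for x y
    unfolding ip_def by (intro sum.cong) auto
  have L_comm: "L x y = L y x" for x y
    unfolding L_def using comm[of x y] ip_comm[of x y] by simp
  have L_cs: "(L x y)\<^sup>2 \<le> L x x * L y y" for x y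
  proof -
    have q: "s\<^sup>2 * L x x + 2 * (s * r) * L x y + r\<^sup>2 * L y y \<ge> 0" for s r
    proof -
      let ?z = "\<lambda>i. s * x i + r * y i"
      have "L ?z ?z = s * L ?z x + r * L ?z y"
        using L_add_left[of s x r y ?z] L_comm[of x ?z] L_comm[of y ?z] by simp
      also have "\<dots> = s\<^sup>2 * L x x + 2 * (s * r) * L x y + r\<^sup>2 * L y y"
        using L_comm[of y x] unfolding L_add_left by (simp add: power2_eq_square algebra_simps)
      finally show ?thesis using L_nonneg[of ?z] by simp
    qed
    show ?thesis
    proof (cases "L y y = 0")
      case False
      then have y: "L y y > 0" using L_nonneg[of y] by simp
      have "L y y * (L y y * L x x - (L x y)\<^sup>2) \<ge> 0"
        using q[of "L y y" "- L x y"] by (simp add: power2_eq_square algebra_simps)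
      then show ?thesis using y by (simp add: zero_le_mult_iff mult.commute)
    next
      case True
      have "L x y = 0"
      proof (rule ccontr)
        assume "L x y \<noteq> 0"
        then show False
          using q[of 1 "- (L x x + 1) / (2 * L x y)"] True by (simp add: field_simps)
      qed
      then show ?thesis using True by simp
    qed
  qed
  have main: "bil V B x x < 0" if xv: "bil V B x v = 0" and x: "\<exists>i\<in>V. x i \<noteq> 0" for x
  proof -
    \<comment> \<open>The rank one term makes the Laplacian definite and the system solvable;
      it vanishes at the solution, because \<open>x\<close> is orthogonal to \<open>v\<close>.\<close>
    define m where "m = (\<lambda>i k. (if i = k then D i else 0) - B i k + (D i * v i) * (D k * v k))"
    have m_row: "(\<Sum>k\<in>V. m i k * y k) = D i * y i - (\<Sum>k\<in>V. B i k * y k) + D i * v i * ip y v"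
      if "i \<in> V" for i y
    proof -
      have "(\<Sum>k\<in>V. m i k * y k) = (\<Sum>k\<in>V. if i = k then D i * y k else 0)
          - (\<Sum>k\<in>V. B i k * y k) + (\<Sum>k\<in>V. (D i * v i) * (D k * y k * v k))"
        unfolding sum_subtractf[symmetric] sum.distrib[symmetric] m_def
        by (intro sum.cong) (auto simp: algebra_simps)
      then show ?thesis using that fin by (simp add: ip_def sum_distrib_left[symmetric])
    qed
    have bil_m: "bil V m z y = L z y + ip z v * ip y v" for z y
    proof -
      have "bil V m z y = (\<Sum>i\<in>V. D i * z i * y i - z i * (\<Sum>k\<in>V. B i k * y k)
          + (D i * z i * v i) * ip y v)"
        unfolding bil_sum_rows
        by (intro sum.cong refl) (simp only: m_row, simp add: algebra_simps)
      then show ?thesis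
        by (simp add: sum.distrib sum_subtractf L_def bil_sum_rows ip_def sum_distrib_right)
    qed
    have "\<exists>y. \<forall>i\<in>V. (\<Sum>k\<in>V. m i k * y k) = D i * x i"
    proof (rule positive_definite_solvable[OF fin])
      show "m j k = m k j" if "j \<in> V" "k \<in> V" for j k
        using symB[OF that] by (auto simp: m_def)
      show "bil V m z z > 0" if z: "\<exists>i\<in>V. z i \<noteq> 0" for z
      proof (rule ccontr)
        assume "\<not> bil V m z z > 0"
        then have "L z z + (ip z v)\<^sup>2 \<le> 0" by (simp add: bil_m power2_eq_square)
        moreover have "(ip z v)\<^sup>2 \<ge> 0" by simp
        ultimately have "L z z = 0" and "(ip z v)\<^sup>2 = 0"
          using L_nonneg[of z] by linarith+
        then have zv: "ip z v = 0" by simp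
        define s where "s = z o' / v o'"
        have zs: "z k = s * v k" if "k \<in> V" for k
          using L_zero[OF \<open>L z z = 0\<close> that] by (simp add: s_def)
        have "ip z v = s * ip v v"
          unfolding ip_def sum_distrib_left by (intro sum.cong) (auto simp: zs)
        moreover have "ip v v > 0" using v[OF o] o by (intro ip_pos) (auto intro!: bexI[of _ o'])
        ultimately have "s = 0" using zv by simp
        then show False using z zs by auto
      qed
    qed
    then obtain y where y: "\<And>i. i \<in> V \<Longrightarrow> (\<Sum>k\<in>V. m i k * y k) = D i * x i" by blast
    have my: "bil V m z y = ip z x" for z
      unfolding bil_sum_rows ip_def by (intro sum.cong) (auto simp: y)
    have "L v y = 0"
      using comm[of v y] ip_v[of y] by (simp add: L_def ip_def algebra_simps)
    moreover have "ip v v > 0" using v[OF o] o by (intro ip_pos) (auto intro!: bexI[of _ o'])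
    moreover have "ip v x = 0" using ip_v[of x] xv by (simp add: ip_def algebra_simps)
    ultimately have yv: "ip y v = 0" using my[of v] bil_m[of v y] by simp
    have Ly: "L z y = ip z x" for z using my[of z] bil_m[of z y] yv by simp
    have By: "bil V (b i) y v = D i * (y i - x i)" if "i \<in> V" for i
      using y[OF that] m_row[OF that, of y] yv row[OF that, of y] by (simp add: algebra_simps)
    have not_prop: "\<forall>s. \<exists>i\<in>V. y i \<noteq> s * v i"
    proof (rule ccontr)
      assume "\<not> ?thesis"
      then obtain s where s: "\<And>i. i \<in> V \<Longrightarrow> y i = s * v i" by blast
      have "ip y v = s * ip v v"
        unfolding ip_def sum_distrib_left by (intro sum.cong) (auto simp: s)
      then have "s = 0" using yv \<open>ip v v > 0\<close> by simp
      then have "ip x x = 0" using Ly[of x] s by (simp add: L_def ip_def bil_def)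
      then show False using ip_pos[OF x] by simp
    qed
    \<comment> \<open>The inequality \<open>A\<^sup>2 \<ge> A\<close> at \<open>y\<close>, where \<open>A y = y - x\<close>.\<close>
    have "bil V B y y < (\<Sum>i\<in>V. D i * (y i - x i)\<^sup>2)"
      unfolding B_sum
    proof (rule sum_strict_mono_ex1[OF fin])
      have eq: "(bil V (b i) y v)\<^sup>2 = (D i * (y i - x i)\<^sup>2 / v i) * bil V (b i) v v"
        if "i \<in> V" for i
        using By[OF that] v[OF that] by (simp add: D_def power2_eq_square)
      have "v i * bil V (b i) y y \<le> D i * (y i - x i)\<^sup>2" if i: "i \<in> V" for i
      proof -
        have "bil V (b i) y y \<le> D i * (y i - x i)\<^sup>2 / v i"
          using rcs[OF i, of y] unfolding eq[OF i] using pos[OF i] by (rule mult_right_le_imp_le)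
        then show ?thesis using v[OF i] by (simp add: field_simps)
      qed
      then show "\<forall>i\<in>V. v i * bil V (b i) y y \<le> D i * (y i - x i)\<^sup>2" by blast
      have "bil V (b o') y y < D o' * (y o' - x o')\<^sup>2 / v o'"
        using strict[OF not_prop] unfolding eq[OF o] using pos[OF o]
        by (metis less_imp_le mult_right_less_imp_less)
      then have "v o' * bil V (b o') y y < D o' * (y o' - x o')\<^sup>2"
        using v[OF o] by (simp add: field_simps)
      then show "\<exists>i\<in>V. v i * bil V (b i) y y < D i * (y i - x i)\<^sup>2" using o by blast
    qed
    also have "(\<Sum>i\<in>V. D i * (y i - x i)\<^sup>2) = ip y y - 2 * ip y x + ip x x"
      unfolding ip_def sum_distrib_left sum_subtractf[symmetric] sum.distrib[symmetric]
      by (intro sum.cong) (auto simp: power2_eq_square algebra_simps)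
    finally have lt: "ip y x < ip x x" using Ly[of y] by (simp add: L_def)
    have pos_x: "ip x x > 0" by (rule ip_pos[OF x])
    have "ip x x * ip x x \<le> L x x * ip y x"
      using L_cs[of x y] Ly[of x] Ly[of y] by (simp add: power2_eq_square)
    moreover have "0 \<le> ip y x" using Ly[of y] L_nonneg[of y] by simp
    ultimately have "ip x x < L x x"
    proof (rule_tac ccontr)
      assume *: "\<not> ip x x < L x x"
      have "L x x * ip y x \<le> ip x x * ip y x"
        using * \<open>0 \<le> ip y x\<close> by (intro mult_right_mono) auto
      also have "\<dots> < ip x x * ip x x" using lt pos_x by simp
      finally show False using \<open>ip x x * ip x x \<le> L x x * ip y x\<close> by simp
    qed
    then show ?thesis by (simp add: L_def)
  qed
  have "bil V B v v > 0"
    unfolding B_sum using o fin v pos by (intro sum_pos) auto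
  then show ?thesis unfolding lorentz_form_def using main symB by blast
qed

section \<open>Derivatives in positive directions\<close>

text \<open>
  A homogeneous polynomial \<open>h\<close> is represented by its derivatives of full order: \<open>T M\<close> is the
  constant obtained by differentiating \<open>h\<close> once in \<open>w\<^sub>i\<close> for each occurrence of \<open>i\<close> in the
  multiset \<open>M\<close>. Symmetry of mixed derivatives is built in. On such tensors \<open>dird V v\<close> is the
  derivative in the direction \<open>v\<close>.
\<close>
definition dird :: "nat set \<Rightarrow> (nat \<Rightarrow> real) \<Rightarrow> (nat multiset \<Rightarrow> real) \<Rightarrow> nat multiset \<Rightarrow> real" where
  "dird V v T M = (\<Sum>i\<in>V. v i * T (add_mset i M))"

lemma dird_commute: "dird V v \<circ> dird V w = dird V w \<circ> dird V v"
proof (intro ext)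
  fix T M
  have "(dird V v \<circ> dird V w) T M = (\<Sum>i\<in>V. \<Sum>j\<in>V. v i * w j * T (add_mset j (add_mset i M)))"
    by (simp add: dird_def sum_distrib_left mult.assoc)
  also have "\<dots> = (\<Sum>j\<in>V. \<Sum>i\<in>V. v i * w j * T (add_mset j (add_mset i M)))"
    by (rule sum.swap)
  also have "\<dots> = (dird V w \<circ> dird V v) T M"
    by (simp add: dird_def sum_distrib_left add_mset_commute ac_simps)
  finally show "(dird V v \<circ> dird V w) T M = (dird V w \<circ> dird V v) T M" .
qed

lemma foldr_dird_Cons:
  "foldr (dird V) (w # ws) T M = (\<Sum>i\<in>V. w i * foldr (dird V) ws T (add_mset i M))"
  by (simp add: dird_def[of V w "foldr (dird V) ws T"])

lemma foldr_dird_add_mset: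
  "foldr (dird V) ws (\<lambda>M. T (add_mset i M)) M = foldr (dird V) ws T (add_mset i M)"
proof (induction ws arbitrary: M)
  case (Cons w ws)
  then show ?case by (simp only: foldr_dird_Cons add_mset_commute[of i])
qed simp

text \<open>
  If the polynomial has no variable \<open>w\<^sub>i\<close>, then the index \<open>i\<close> can be removed from all
  directions.
\<close>
lemma foldr_dird_avoid:
  assumes "finite V" "i \<in> V"
  shows "foldr (dird V) ws (\<lambda>M. if i \<in># M then 0 else T M) M
    = (if i \<in># M then 0 else foldr (dird (V - {i})) ws T M)"
proof (induction ws arbitrary: M)
  case (Cons w ws)
  show ?case
    unfolding foldr_dird_Cons Cons.IH sum.remove[OF assms] by (auto intro!: sum.cong)
qed simp

lemma foldr_dird_nonneg:
  assumes "\<And>w i. \<lbrakk>w \<in> set ws; i \<in> V\<rbrakk> \<Longrightarrow> w i > 0"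
    and "\<And>M. set_mset M \<subseteq> V \<Longrightarrow> T M \<ge> 0" and "set_mset M \<subseteq> V"
  shows "foldr (dird V) ws T M \<ge> 0"
  using assms(1,3)
proof (induction ws arbitrary: M)
  case (Cons w ws)
  have "foldr (dird V) ws T (add_mset i M) \<ge> 0" if "i \<in> V" for i
    using Cons.prems that by (intro Cons.IH) auto
  then show ?case using Cons.prems(1)[of w] unfolding foldr_dird_Cons
    by (auto simp: less_imp_le intro!: sum_nonneg mult_nonneg_nonneg)
qed (simp add: assms(2))

text \<open>
  The tensor of the polynomial \<open>\<Sum>\<^bsub>S\<^esub> c S * w\<^sub>0\<^sup>k / k! * (\<Prod>i\<in>S. w\<^sub>i)\<close>, where \<open>k\<close> is the degree
  minus the cardinality of \<open>S\<close>. The factorials make the weights \<open>c\<close> independent of the degree,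
  so that the derivative in \<open>w\<^sub>0\<close> preserves \<open>c\<close>, while the derivative in another \<open>w\<^sub>i\<close> replaces
  \<open>c\<close> by its contraction \<open>c \<circ> insert i\<close>.
\<close>
definition sq_tensor :: "(nat set \<Rightarrow> real) \<Rightarrow> nat multiset \<Rightarrow> real" where
  "sq_tensor c M = (if \<forall>i. i \<noteq> 0 \<longrightarrow> count M i \<le> 1 then c (set_mset M - {0}) else 0)"

lemma sq_tensor_add_zero: "sq_tensor c (add_mset 0 M) = sq_tensor c M"
proof -
  have "(\<forall>j. j \<noteq> 0 \<longrightarrow> count (add_mset 0 M) j \<le> 1) \<longleftrightarrow> (\<forall>j. j \<noteq> 0 \<longrightarrow> count M j \<le> 1)"
    by simp
  moreover have "set_mset (add_mset 0 M) - {0} = set_mset M - {0}" by auto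
  ultimately show ?thesis unfolding sq_tensor_def by (simp only:)
qed

lemma sq_tensor_add:
  assumes "i \<noteq> 0"
  shows "sq_tensor c (add_mset i M)
    = (if i \<in># M then 0 else sq_tensor (\<lambda>S. c (insert i S)) M)"
proof -
  have "(\<forall>j. j \<noteq> 0 \<longrightarrow> count (add_mset i M) j \<le> 1) \<longleftrightarrow>
      i \<notin># M \<and> (\<forall>j. j \<noteq> 0 \<longrightarrow> count M j \<le> 1)"
  proof (intro iffI conjI allI impI)
    assume *: "\<forall>j. j \<noteq> 0 \<longrightarrow> count (add_mset i M) j \<le> 1"
    show "i \<notin># M" using *[rule_format, OF assms] by (simp add: not_in_iff)
    show "count M j \<le> 1" if "j \<noteq> 0" for j :: nat
      using *[rule_format, OF that] by (simp split: if_splits)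
  next
    fix j :: nat assume "i \<notin># M \<and> (\<forall>j. j \<noteq> 0 \<longrightarrow> count M j \<le> 1)" "j \<noteq> 0"
    then show "count (add_mset i M) j \<le> 1" by (auto simp: not_in_iff)
  qed
  moreover have "set_mset (add_mset i M) - {0} = insert i (set_mset M - {0})"
    using assms by auto
  ultimately have "sq_tensor c (add_mset i M)
    = (if i \<notin># M \<and> (\<forall>j. j \<noteq> 0 \<longrightarrow> count M j \<le> 1) then c (insert i (set_mset M - {0})) else 0)"
    unfolding sq_tensor_def by (simp only:)
  then show ?thesis unfolding sq_tensor_def by (cases "i \<in># M") (simp_all only: simp_thms if_True if_False)
qed

lemma foldr_dird_sq_tensor_pos:
  assumes "finite V" "0 \<in> V"
    and "\<And>w i. \<lbrakk>w \<in> set ws; i \<in> V\<rbrakk> \<Longrightarrow> w i > 0"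
    and c: "\<And>S. S \<subseteq> V - {0} \<Longrightarrow> c S > 0"
    and "set_mset M \<subseteq> V" and "\<And>i. i \<noteq> 0 \<Longrightarrow> count M i \<le> 1"
  shows "foldr (dird V) ws (sq_tensor c) M > 0"
  using assms(3,5,6)
proof (induction ws arbitrary: M)
  case Nil
  then show ?case by (auto simp: sq_tensor_def intro!: c)
next
  case (Cons w ws)
  have nn: "w i * foldr (dird V) ws (sq_tensor c) (add_mset i M) \<ge> 0" if "i \<in> V" for i
  proof (intro mult_nonneg_nonneg foldr_dird_nonneg)
    show "sq_tensor c M \<ge> 0" if "set_mset M \<subseteq> V" for M
    proof -
      have "c (set_mset M - {0}) > 0" by (rule c) (use that in auto)
      then show ?thesis by (simp add: sq_tensor_def)
    qed
  qed (use Cons.prems that in \<open>auto simp: less_imp_le\<close>)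
  have "foldr (dird V) ws (sq_tensor c) (add_mset 0 M) > 0"
    using Cons.prems assms(2) by (intro Cons.IH) auto
  then have "w 0 * foldr (dird V) ws (sq_tensor c) (add_mset 0 M) > 0"
    using Cons.prems(1)[of w 0] assms(2) by simp
  then show ?case
    unfolding foldr_dird_Cons by (rule sum_pos2[OF assms(1,2)]) (rule nn)
qed

text \<open>
  The right hand side minus the left hand side is the discriminant with respect to \<open>w\<^sub>0\<close> of the
  quadratic form belonging to the contraction of \<open>c\<close> by \<open>T\<close>. So for positive \<open>c\<close> the condition says that these
  quadratic forms are all Lorentzian and nondegenerate.
\<close>
definition strictly_locally_log_concave :: "nat set \<Rightarrow> (nat set \<Rightarrow> real) \<Rightarrow> bool" where
  "strictly_locally_log_concave E c \<longleftrightarrow> (\<forall>T x. T \<subseteq> E \<and> (\<exists>i\<in>E - T. x i \<noteq> 0) \<longrightarrow>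
     c T * (\<Sum>i\<in>E - T. \<Sum>j\<in>E - T - {i}. c (insert i (insert j T)) * x i * x j)
       < (\<Sum>i\<in>E - T. c (insert i T) * x i)\<^sup>2)"

lemma strictly_locally_log_concave_contract:
  assumes "strictly_locally_log_concave E c" and "i \<in> E"
  shows "strictly_locally_log_concave (E - {i}) (\<lambda>S. c (insert i S))"
  unfolding strictly_locally_log_concave_def
proof (intro allI impI)
  fix T :: "nat set" and x :: "nat \<Rightarrow> real"
  assume T: "T \<subseteq> E - {i} \<and> (\<exists>j\<in>E - {i} - T. x j \<noteq> 0)"
  have E: "E - insert i T = E - {i} - T" by auto
  have "insert i T \<subseteq> E \<and> (\<exists>j\<in>E - insert i T. x j \<noteq> 0)" using T assms(2) E by auto
  then have "c (insert i T) * (\<Sum>j\<in>E - {i} - T. \<Sum>k\<in>E - {i} - T - {j}.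
        c (insert j (insert k (insert i T))) * x j * x k)
      < (\<Sum>j\<in>E - {i} - T. c (insert j (insert i T)) * x j)\<^sup>2"
    using assms(1) unfolding strictly_locally_log_concave_def E[symmetric] by blast
  moreover have "insert j (insert k (insert i T)) = insert i (insert j (insert k T))" for j k
    by auto
  moreover have "insert j (insert i T) = insert i (insert j T)" for j by auto
  ultimately show "c (insert i T) * (\<Sum>j\<in>E - {i} - T. \<Sum>k\<in>E - {i} - T - {j}.
        c (insert i (insert j (insert k T))) * x j * x k)
      < (\<Sum>j\<in>E - {i} - T. c (insert i (insert j T)) * x j)\<^sup>2" by simp
qed

text \<open>
  The square of the coordinate vector of \<open>w\<^sub>0\<close> is positive. Eliminating \<open>w\<^sub>0\<close> on its complement
  leaves a negative multiple of the discriminant.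
\<close>
lemma lorentz_form_sq_tensor:
  assumes fin: "finite E" and E0: "0 \<notin> E" and c: "c {} > 0"
    and local: "strictly_locally_log_concave E c"
  shows "lorentz_form (insert 0 E) (\<lambda>j k. sq_tensor c {#j, k#})"
proof -
  define a where "a = (\<lambda>j k. sq_tensor c {#j, k#})"
  have sym: "a j k = a k j" for j k by (simp add: a_def add_mset_commute)
  have a00: "a 0 0 = c {}" by (simp add: a_def sq_tensor_def)
  have a0: "a 0 k = c {k}" if "k \<in> E" for k
    using that E0 by (auto simp: a_def sq_tensor_def intro!: arg_cong[where f = c])
  have aE: "a j k = (if j = k then 0 else c (insert j (insert k {})))" if "j \<in> E" "k \<in> E" for j k
  proof -
    have "j \<noteq> 0" "k \<noteq> 0" using that E0 by metis+
    then show ?thesis by (auto simp: a_def sq_tensor_add sq_tensor_def[of _ "{#}"])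
  qed
  have exp: "bil (insert 0 E) a x x
      = c {} * (x 0)\<^sup>2 + 2 * x 0 * (\<Sum>k\<in>E. c {k} * x k) + bil E a x x" for x
  proof -
    have "(\<Sum>j\<in>E. a j 0 * x j * x 0) = x 0 * (\<Sum>k\<in>E. c {k} * x k)"
      unfolding sum_distrib_left using sym[of _ 0] a0 by (intro sum.cong) auto
    moreover have "(\<Sum>k\<in>E. a 0 k * x 0 * x k) = x 0 * (\<Sum>k\<in>E. c {k} * x k)"
      unfolding sum_distrib_left using a0 by (intro sum.cong) auto
    ultimately show ?thesis
      using fin E0 a00 by (simp add: bil_def sum.distrib power2_eq_square)
  qed
  have bilE: "bil E a x x = (\<Sum>j\<in>E. \<Sum>k\<in>E - {j}. c (insert j (insert k {})) * x j * x k)" for x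
    unfolding bil_def
  proof (rule sum.cong[OF refl])
    fix j assume j: "j \<in> E"
    show "(\<Sum>k\<in>E. a j k * x j * x k) = (\<Sum>k\<in>E - {j}. c (insert j (insert k {})) * x j * x k)"
      unfolding sum.remove[OF fin j] using j aE by (auto intro!: sum.cong)
  qed
  let ?u = "\<lambda>i::nat. if i = 0 then 1 else 0 :: real"
  have xu: "bil (insert 0 E) a x ?u = c {} * x 0 + (\<Sum>k\<in>E. c {k} * x k)" for x
  proof -
    have "(\<Sum>k\<in>insert 0 E. a j k * x j * ?u k) = a 0 j * x j" for j
    proof -
      have "(\<Sum>k\<in>E. a j k * x j * ?u k) = 0" using E0 by (intro sum.neutral) auto
      then show ?thesis using fin E0 sym[of j 0] by simp
    qed
    then show ?thesis unfolding bil_def using fin E0 a0 a00 by (simp add: bil_def)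
  qed
  have "bil (insert 0 E) a x x < 0"
    if x0: "bil (insert 0 E) a x ?u = 0" and x: "\<exists>i\<in>insert 0 E. x i \<noteq> 0" for x
  proof -
    define s where "s = (\<Sum>k\<in>E. c {k} * x k)"
    have x0': "x 0 = - s / c {}" using x0 c unfolding xu s_def by (simp add: field_simps)
    have "\<exists>i\<in>E. x i \<noteq> 0"
    proof (rule ccontr)
      assume "\<not> ?thesis"
      moreover from this have "x 0 = 0" unfolding x0' by (simp add: s_def)
      ultimately show False using x by blast
    qed
    then have "c {} * bil E a x x < s\<^sup>2"
      using local[unfolded strictly_locally_log_concave_def, rule_format, of "{}" x]
      unfolding bilE s_def by simp
    then have "c {} * (bil (insert 0 E) a x x) < 0"
      unfolding exp s_def[symmetric] x0' using c by (simp add: field_simps power2_eq_square)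
    then show ?thesis using c by (simp add: mult_less_0_iff)
  qed
  moreover have "bil (insert 0 E) a ?u ?u > 0"
    unfolding xu using c E0 by (simp add: sum.neutral)
  ultimately show ?thesis unfolding lorentz_form_def a_def[symmetric] using sym by blast
qed

text \<open>
  Induction on the number of directions. The slices needed for \<open>lorentz_form_of_slices\<close> come
  from the derivative in \<open>w\<^sub>0\<close>, which keeps \<open>c\<close> and yields the strict slice, and from the
  derivatives in the other \<open>w\<^sub>i\<close>, which contract \<open>c\<close>. The latter do not depend on \<open>w\<^sub>i\<close>, so
  their forms are degenerate on the full index set and only a weak inequality survives.
\<close>
lemma lorentz_form_dird:
  assumes "finite E" "0 \<notin> E" "\<And>S. S \<subseteq> E \<Longrightarrow> c S > 0" "strictly_locally_log_concave E c"
    and "\<And>v i. \<lbrakk>v \<in> set vs; i \<in> insert 0 E\<rbrakk> \<Longrightarrow> v i > 0"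
  shows "lorentz_form (insert 0 E) (\<lambda>j k. foldr (dird (insert 0 E)) vs (sq_tensor c) {#j, k#})"
  using assms
proof (induction vs arbitrary: E c)
  case Nil
  then show ?case using lorentz_form_sq_tensor[of E c] by simp
next
  case (Cons v ws)
  define V where "V = insert 0 E"
  define S where "S = foldr (dird V) ws (sq_tensor c)"
  have fin: "finite V" and o: "0 \<in> V" using Cons.prems by (auto simp: V_def)
  have VE: "V - {0} = E" using Cons.prems by (auto simp: V_def)
  have vpos: "v i > 0" if "i \<in> V" for i using Cons.prems that by (auto simp: V_def)
  have wspos: "w i > 0" if "w \<in> set ws" "i \<in> V" for w i using Cons.prems(5)[of w i] that by (auto simp: V_def)
  have cpos: "c S > 0" if "S \<subseteq> V - {0}" for S using Cons.prems(3) that VE by auto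
  have Spos: "S M > 0" if "set_mset M \<subseteq> V" "\<And>i. i \<noteq> 0 \<Longrightarrow> count M i \<le> 1" for M
    unfolding S_def by (rule foldr_dird_sq_tensor_pos[OF fin o]) (use wspos cpos that in auto)
  have Snonneg: "S M \<ge> 0" if "set_mset M \<subseteq> V" for M
    unfolding S_def
  proof (rule foldr_dird_nonneg)
    show "w i > 0" if "w \<in> set ws" "i \<in> V" for w i using that by (rule wspos)
    show "set_mset M \<subseteq> V" by (rule that)
    show "sq_tensor c M \<ge> 0" if "set_mset M \<subseteq> V" for M
    proof -
      have "c (set_mset M - {0}) > 0" by (rule cpos) (use that in auto)
      then show ?thesis by (simp add: sq_tensor_def)
    qed
  qed
  define b where "b = (\<lambda>i j k. S {#i, j, k#})"
  have slice0: "lorentz_form V (b 0)"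
  proof -
    have "b 0 j k = foldr (dird V) ws (sq_tensor c) {#j, k#}" for j k
      using foldr_dird_add_mset[of V ws "sq_tensor c" 0 "{#j, k#}"]
      by (simp add: b_def S_def sq_tensor_add_zero)
    then have "b 0 = (\<lambda>j k. foldr (dird V) ws (sq_tensor c) {#j, k#})" by (intro ext)
    moreover have "lorentz_form V (\<lambda>j k. foldr (dird V) ws (sq_tensor c) {#j, k#})"
      unfolding V_def by (rule Cons.IH[OF Cons.prems(1-4)]) (use Cons.prems(5) in auto)
    ultimately show ?thesis by simp
  qed
  have rcs: "bil V (b i) x x * bil V (b i) v v \<le> (bil V (b i) x v)\<^sup>2"
    and bpos: "bil V (b i) v v > 0" if i: "i \<in> V" for i x
  proof -
    have i00: "b i 0 0 > 0" unfolding b_def by (rule Spos) (use i o in auto)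
    have "bil V (b i) v v > 0" unfolding bil_def
    proof (rule sum_pos2[OF fin o])
      have nn: "b i j k * v j * v k \<ge> 0" if "j \<in> V" "k \<in> V" for j k
        unfolding b_def using that i vpos
        by (intro mult_nonneg_nonneg Snonneg) (auto simp: less_imp_le)
      show "(\<Sum>k\<in>V. b i 0 k * v 0 * v k) > 0"
        by (rule sum_pos2[OF fin o]) (use i00 vpos[OF o] nn[OF o] in auto)
      show "(\<Sum>k\<in>V. b i j k * v j * v k) \<ge> 0" if "j \<in> V" for j
        by (rule sum_nonneg) (rule nn[OF that])
    qed
    then show pos: "bil V (b i) v v > 0" .
    show "bil V (b i) x x * bil V (b i) v v \<le> (bil V (b i) x v)\<^sup>2"
    proof (cases "i = 0")
      case True
      then show ?thesis using reverse_cauchy_schwarz(1)[OF slice0] pos by simp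
    next
      case False
      then have iE: "i \<in> E" using i VE by auto
      define c' where "c' = (\<lambda>S. c (insert i S))"
      define b' where "b' = (\<lambda>j k. foldr (dird (V - {i})) ws (sq_tensor c') {#j, k#})"
      have V': "V - {i} = insert 0 (E - {i})" using False by (auto simp: V_def)
      have L: "lorentz_form (V - {i}) b'"
        unfolding b'_def V'
      proof (rule Cons.IH)
        show "strictly_locally_log_concave (E - {i}) c'"
          unfolding c'_def by (rule strictly_locally_log_concave_contract[OF Cons.prems(4) iE])
        show "c' S > 0" if "S \<subseteq> E - {i}" for S
          unfolding c'_def using that iE by (intro Cons.prems(3)) auto
      qed (use Cons.prems in auto)
      have b: "b i j k = (if j = i \<or> k = i then 0 else b' j k)" for j k
      proof -
        have "b i j k = foldr (dird V) ws (\<lambda>M. sq_tensor c (add_mset i M)) {#j, k#}"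
          by (simp add: b_def S_def foldr_dird_add_mset)
        then show ?thesis
          by (auto simp: sq_tensor_add[OF False] foldr_dird_avoid[OF fin i] b'_def c'_def)
      qed
      have "bil V (b i) y z = bil (V - {i}) b' y z" for y z
        unfolding bil_def sum.remove[OF fin i] by (auto simp: b intro!: sum.cong)
      then show ?thesis using reverse_cauchy_schwarz(1)[OF L] pos by simp
    qed
  qed
  have "lorentz_form V (\<lambda>j k. \<Sum>i\<in>V. v i * b i j k)"
  proof (rule lorentz_form_of_slices[OF fin o vpos])
    show "b i j k = b j i k" "b i j k = b i k j" for i j k
      by (simp_all add: b_def add_mset_commute)
    show "bil V (b 0) x x * bil V (b 0) v v < (bil V (b 0) x v)\<^sup>2"
      if "\<forall>s. \<exists>i\<in>V. x i \<noteq> s * v i" for x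
      by (rule reverse_cauchy_schwarz(2)[OF slice0 bpos[OF o] that])
    have nn: "v i * b i j k \<ge> 0" if "i \<in> V" "j \<in> V" "k \<in> V" for i j k
      unfolding b_def using that vpos by (intro mult_nonneg_nonneg Snonneg) (auto simp: less_imp_le)
    show "(\<Sum>i\<in>V. v i * b i j k) \<ge> 0" if "j \<in> V" "k \<in> V" for j k
      using nn that by (intro sum_nonneg)
    show "(\<Sum>i\<in>V. v i * b i 0 k) > 0" if k: "k \<in> V" for k
    proof (rule sum_pos2[OF fin o])
      have "b 0 0 k > 0" unfolding b_def by (rule Spos) (use k o in auto)
      then show "v 0 * b 0 0 k > 0" using vpos[OF o] by simp
    qed (rule nn[OF _ o k])
  qed (use rcs bpos in auto)
  then show ?case unfolding foldr_dird_Cons by (simp only: b_def S_def V_def)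
qed

section \<open>Log-concave weights from matroid quotients\<close>

text \<open>
  The pairs related by the equivalence relation contribute the sum of the squares of the class
  sums. There are at most \<open>card X\<close> classes, so Cauchy-Schwarz bounds it from below.
\<close>
lemma separated_pairs_sum_le:
  fixes y :: "'a \<Rightarrow> real"
  assumes fin: "finite X"
    and reflR: "\<And>i. i \<in> X \<Longrightarrow> R i i"
    and sym: "\<And>i j. \<lbrakk>i \<in> X; j \<in> X; R i j\<rbrakk> \<Longrightarrow> R j i"
    and trans: "\<And>i j k. \<lbrakk>i \<in> X; j \<in> X; k \<in> X; R i j; R j k\<rbrakk> \<Longrightarrow> R i k"
  shows "real (card X) * (\<Sum>i\<in>X. \<Sum>j\<in>X. if R i j then 0 else y i * y j)
    \<le> (real (card X) - 1) * (\<Sum>i\<in>X. y i)\<^sup>2"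
proof -
  define f where "f = (\<lambda>i. {j \<in> X. R i j})"
  have R: "R i j \<longleftrightarrow> f i = f j" if "i \<in> X" "j \<in> X" for i j
    unfolding f_def using reflR sym trans that by blast
  define g where "g = (\<lambda>b. \<Sum>i | i \<in> X \<and> f i = b. y i)"
  have "(\<Sum>i\<in>X. \<Sum>j\<in>X. if R i j then y i * y j else 0)
      = (\<Sum>i\<in>X. y i * g (f i))"
  proof (rule sum.cong[OF refl])
    fix i assume i: "i \<in> X"
    have "(\<Sum>j\<in>X. if R i j then y i * y j else 0) = (\<Sum>j\<in>X. if f j = f i then y i * y j else 0)"
      using i R by (intro sum.cong) auto
    also have "\<dots> = (\<Sum>j | j \<in> X \<and> f j = f i. y i * y j)"
      using fin by (simp add: sum.inter_filter)
    finally show "(\<Sum>j\<in>X. if R i j then y i * y j else 0) = y i * g (f i)"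
      by (simp add: g_def sum_distrib_left)
  qed
  also have "\<dots> = (\<Sum>b\<in>f ` X. \<Sum>i | i \<in> X \<and> f i = b. y i * g (f i))"
    by (rule sum.image_gen[OF fin])
  also have "\<dots> = (\<Sum>b\<in>f ` X. (g b)\<^sup>2)"
  proof (rule sum.cong)
    fix b
    have "(\<Sum>i | i \<in> X \<and> f i = b. y i * g (f i)) = (\<Sum>i | i \<in> X \<and> f i = b. y i) * g b"
      unfolding sum_distrib_right by (intro sum.cong) auto
    then show "(\<Sum>i | i \<in> X \<and> f i = b. y i * g (f i)) = (g b)\<^sup>2"
      by (simp add: g_def power2_eq_square)
  qed simp
  finally have related: "(\<Sum>i\<in>X. \<Sum>j\<in>X. if R i j then y i * y j else 0) = (\<Sum>b\<in>f ` X. (g b)\<^sup>2)" .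
  have "(\<Sum>i\<in>X. y i) = (\<Sum>b\<in>f ` X. g b)"
    unfolding g_def by (rule sum.image_gen[OF fin])
  moreover have "(\<Sum>b\<in>f ` X. g b)\<^sup>2 \<le> real (card (f ` X)) * (\<Sum>b\<in>f ` X. (g b)\<^sup>2)"
  proof -
    have "0 \<le> (\<Sum>b\<in>f ` X. \<Sum>c\<in>f ` X. (g b - g c)\<^sup>2)" by (intro sum_nonneg) auto
    also have "\<dots> = (\<Sum>b\<in>f ` X. \<Sum>c\<in>f ` X. (g b)\<^sup>2 + (g c)\<^sup>2 - 2 * (g b * g c))"
      by (intro sum.cong) (auto simp: power2_diff)
    also have "\<dots> = 2 * (real (card (f ` X)) * (\<Sum>b\<in>f ` X. (g b)\<^sup>2)) - 2 * (\<Sum>b\<in>f ` X. g b)\<^sup>2"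
      unfolding sum.distrib sum_subtractf sum_distrib_left[symmetric]
      by (simp add: sum_product[symmetric] power2_eq_square sum_distrib_left[symmetric]
          sum_distrib_right[symmetric])
    finally show ?thesis by simp
  qed
  ultimately have "(\<Sum>i\<in>X. y i)\<^sup>2 \<le> real (card (f ` X)) * (\<Sum>b\<in>f ` X. (g b)\<^sup>2)"
    by simp
  also have "\<dots> \<le> real (card X) * (\<Sum>b\<in>f ` X. (g b)\<^sup>2)"
    using card_image_le[OF fin, of f] by (intro mult_right_mono sum_nonneg) auto
  finally have cs: "(\<Sum>i\<in>X. y i)\<^sup>2 \<le> real (card X) * (\<Sum>b\<in>f ` X. (g b)\<^sup>2)" .
  have "(\<Sum>i\<in>X. \<Sum>j\<in>X. if R i j then 0 else y i * y j)
      = (\<Sum>i\<in>X. \<Sum>j\<in>X. y i * y j - (if R i j then y i * y j else 0))"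
    by (intro sum.cong) auto
  also have "\<dots> = (\<Sum>i\<in>X. y i)\<^sup>2 - (\<Sum>b\<in>f ` X. (g b)\<^sup>2)"
    unfolding sum_subtractf related by (simp add: power2_eq_square sum_product)
  finally have separated: "(\<Sum>i\<in>X. \<Sum>j\<in>X. if R i j then 0 else y i * y j)
      = (\<Sum>i\<in>X. y i)\<^sup>2 - (\<Sum>b\<in>f ` X. (g b)\<^sup>2)" .
  show ?thesis unfolding separated using cs by (simp add: algebra_simps)
qed

text \<open>
  Compared with a matroid, a rank function is only required to grow by at most one with each
  element. The map \<open>S \<mapsto> s (f ` S)\<close> obtained from a morphism is of this kind, and both rank
  functions then live on the same ground set.
\<close>
definition rank_function :: "'a set \<Rightarrow> ('a set \<Rightarrow> nat) \<Rightarrow> bool" where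
  "rank_function E r \<longleftrightarrow>
     (\<forall>S T. S \<subseteq> T \<and> T \<subseteq> E \<longrightarrow> r S \<le> r T) \<and>
     (\<forall>S T. S \<subseteq> E \<and> T \<subseteq> E \<longrightarrow> r (S \<union> T) + r (S \<inter> T) \<le> r S + r T) \<and>
     (\<forall>S i. insert i S \<subseteq> E \<longrightarrow> r (insert i S) \<le> r S + 1)"

text \<open>
  That is, \<open>i\<close> and \<open>j\<close> are parallel nonloops of the contraction by \<open>T\<close>.
\<close>
definition parallel_over :: "('a set \<Rightarrow> nat) \<Rightarrow> 'a set \<Rightarrow> 'a \<Rightarrow> 'a \<Rightarrow> bool" where
  "parallel_over r T i j \<longleftrightarrow>
     r (insert i T) = r T + 1 \<and> r (insert j T) = r T + 1 \<and> r (insert i (insert j T)) = r T + 1"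

lemma rank_function_mono: "\<lbrakk>rank_function E r; S \<subseteq> T; T \<subseteq> E\<rbrakk> \<Longrightarrow> r S \<le> r T"
  unfolding rank_function_def by blast

lemma rank_function_insert: "\<lbrakk>rank_function E r; insert i S \<subseteq> E\<rbrakk> \<Longrightarrow> r (insert i S) \<le> r S + 1"
  unfolding rank_function_def by blast

lemma rank_function_submodular:
  "\<lbrakk>rank_function E r; S \<subseteq> E; T \<subseteq> E\<rbrakk> \<Longrightarrow> r (S \<union> T) + r (S \<inter> T) \<le> r S + r T"
  unfolding rank_function_def by blast

lemma rank_function_exchange:
  assumes r: "rank_function E r" and "insert i (insert j T) \<subseteq> E"
  shows "r (insert i (insert j T)) + r T \<le> r (insert i T) + r (insert j T)"
proof (cases "i = j")
  case True
  then show ?thesis using rank_function_mono[OF r, of T "insert j T"] assms by auto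
next
  case False
  have "r (insert i T \<union> insert j T) + r (insert i T \<inter> insert j T) \<le> r (insert i T) + r (insert j T)"
    using assms by (intro rank_function_submodular) auto
  moreover have "insert i T \<union> insert j T = insert i (insert j T)" by auto
  moreover have "r T \<le> r (insert i T \<inter> insert j T)"
    using assms by (intro rank_function_mono[OF r]) auto
  ultimately show ?thesis by simp
qed

lemma parallel_over_sym: "parallel_over r T i j \<Longrightarrow> parallel_over r T j i"
  by (simp add: parallel_over_def insert_commute)

lemma parallel_over_trans:
  assumes r: "rank_function E r" and sub: "insert i (insert j (insert k T)) \<subseteq> E"
    and ij: "parallel_over r T i j" and jk: "parallel_over r T j k"
  shows "parallel_over r T i k"
proof -
  have "r (insert i (insert k (insert j T))) + r (insert j T)
      \<le> r (insert i (insert j T)) + r (insert k (insert j T))"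
    using sub by (intro rank_function_exchange[OF r]) auto
  moreover have "r (insert i (insert k T)) \<le> r (insert i (insert k (insert j T)))"
    using sub by (intro rank_function_mono[OF r]) auto
  moreover have "r (insert i T) \<le> r (insert i (insert k T))"
    using sub by (intro rank_function_mono[OF r]) auto
  ultimately show ?thesis
    using ij jk by (simp add: parallel_over_def insert_commute)
qed

text \<open>
  The only source of failure of modularity at two elements is that they are parallel. This
  evaluates the ratios of neighbouring weights below.
\<close>
lemma rank_sum_parallel:
  assumes r: "rank_function E r" and sub: "insert i (insert j T) \<subseteq> E"
  shows "r (insert i T) + r (insert j T)
    = r T + r (insert i (insert j T)) + (if parallel_over r T i j then 1 else 0)"
proof -
  have ex: "r (insert i (insert j T)) + r T \<le> r (insert i T) + r (insert j T)"
    by (rule rank_function_exchange[OF r sub])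
  have "r (insert i (insert j T)) \<ge> r (insert i T)" "r (insert i (insert j T)) \<ge> r (insert j T)"
    "r (insert i T) \<ge> r T" "r (insert j T) \<ge> r T"
    using sub by (auto intro!: rank_function_mono[OF r])
  moreover have "r (insert i T) \<le> r T + 1" "r (insert j T) \<le> r T + 1"
    using sub by (auto intro!: rank_function_insert[OF r, simplified])
  ultimately show ?thesis using ex unfolding parallel_over_def by auto
qed

definition matroid_quotient :: "'a set \<Rightarrow> ('a set \<Rightarrow> nat) \<Rightarrow> ('a set \<Rightarrow> nat) \<Rightarrow> bool" where
  "matroid_quotient E r s \<longleftrightarrow> rank_function E r \<and> rank_function E s \<and>
     (\<forall>S T. S \<subseteq> T \<and> T \<subseteq> E \<longrightarrow> s T + r S \<le> r T + s S)"

text \<open>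
  A parallel class of the first rank function is not torn apart by a quotient, except that its
  elements may all become loops.
\<close>
lemma parallel_over_quotient:
  assumes Q: "matroid_quotient E r s" and sub: "insert i (insert j T) \<subseteq> E"
    and p: "parallel_over r T i j"
  shows "parallel_over s T i j \<or> s (insert i T) = s T \<and> s (insert j T) = s T"
proof -
  have s: "rank_function E s"
    and q: "\<And>S T. S \<subseteq> T \<Longrightarrow> T \<subseteq> E \<Longrightarrow> s T + r S \<le> r T + s S"
    using Q unfolding matroid_quotient_def by auto
  have "s (insert i (insert j T)) + r (insert i T) \<le> r (insert i (insert j T)) + s (insert i T)"
    "s (insert i (insert j T)) + r (insert j T) \<le> r (insert i (insert j T)) + s (insert j T)"
    using sub by (auto intro!: q)
  moreover have "s (insert i (insert j T)) \<ge> s (insert i T)"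
    "s (insert i (insert j T)) \<ge> s (insert j T)" "s (insert i T) \<ge> s T" "s (insert j T) \<ge> s T"
    using sub by (auto intro!: rank_function_mono[OF s])
  moreover have "s (insert i T) \<le> s T + 1" "s (insert j T) \<le> s T + 1"
    using sub by (auto intro!: rank_function_insert[OF s, simplified])
  ultimately show ?thesis using p unfolding parallel_over_def by auto
qed

text \<open>
  The key observation is that \<open>u\<close> is a convex combination of four indicators of not being
  related: by being parallel for \<open>r\<close> (weight \<open>q (1 - p)\<close>), by equality (\<open>q p\<close>), by being
  parallel for \<open>r\<close> or for \<open>s\<close> (\<open>(1 - q) (1 - p)\<close>), and by being parallel for \<open>s\<close> (\<open>(1 - q) p\<close>).
  All four are equivalence relations; for the third one this is where the quotient property
  enters. So \<open>separated_pairs_sum_le\<close> applies to each of them. The result is strict because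
  \<open>t < 1\<close> if the sum of \<open>y\<close> is nonzero, and because equality has the positive weight \<open>q p\<close>
  otherwise.
\<close>
lemma quotient_pairs_strict:
  fixes y :: "'a \<Rightarrow> real" and p q t :: real
  defines "u \<equiv> (\<lambda>r s T i j. (if parallel_over r T i j then p else 1) * (if parallel_over s T i j then q else 1))"
  assumes Q: "matroid_quotient E r s" and fin: "finite X" and sub: "X \<union> T \<subseteq> E"
    and N: "card X \<ge> 2" and y: "\<exists>i\<in>X. y i \<noteq> 0"
    and p: "0 < p" "p < 1" and q: "0 < q" "q < 1" and t: "0 < t" "t < 1"
  shows "real (card X) * (t * (\<Sum>i\<in>X. \<Sum>j\<in>X - {i}. u r s T i j * (y i * y j)))
    < (real (card X) - 1) * (\<Sum>i\<in>X. y i)\<^sup>2"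
proof -
  have r: "rank_function E r" and s: "rank_function E s"
    using Q unfolding matroid_quotient_def by auto
  let ?P = "parallel_over r T" and ?Q = "parallel_over s T"
  define W where "W = (\<lambda>R. \<Sum>i\<in>X. \<Sum>j\<in>X. if R i j then 0 else y i * y j)"
  define N' where "N' = real (card X)"
  define Y where "Y = (\<Sum>i\<in>X. y i)"
  define U where "U = (\<Sum>i\<in>X. \<Sum>j\<in>X - {i}. u r s T i j * (y i * y j))"
  have in_E: "insert i (insert j T) \<subseteq> E" "insert i (insert j (insert k T)) \<subseteq> E"
    if "i \<in> X" "j \<in> X" "k \<in> X" for i j k
    using sub that by auto
  note tr = parallel_over_trans[OF r in_E(2)] parallel_over_trans[OF s in_E(2)]
  have mixed: "?Q i k" if "i \<in> X" "j \<in> X" "k \<in> X" "?P i j" "?Q j k" for i j k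
  proof -
    have "?Q i j"
      using parallel_over_quotient[OF Q in_E(1)[OF that(1,2,2)] that(4)] that(5)
      by (auto simp: parallel_over_def)
    then show ?thesis using tr(2)[OF that(1-3)] that(5) by blast
  qed
  have W_M: "N' * W (\<lambda>i j. i = j \<or> ?P i j) \<le> (N' - 1) * Y\<^sup>2"
    unfolding N'_def W_def Y_def
    by (rule separated_pairs_sum_le[OF fin]) (auto dest: parallel_over_sym tr(1))
  have W_N: "N' * W (\<lambda>i j. i = j \<or> ?Q i j) \<le> (N' - 1) * Y\<^sup>2"
    unfolding N'_def W_def Y_def
    by (rule separated_pairs_sum_le[OF fin]) (auto dest: parallel_over_sym tr(2))
  have W_U: "N' * W (\<lambda>i j. i = j \<or> ?P i j \<or> ?Q i j) \<le> (N' - 1) * Y\<^sup>2"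
    unfolding N'_def W_def Y_def
  proof (rule separated_pairs_sum_le[OF fin])
    fix i j k assume ijk: "i \<in> X" "j \<in> X" "k \<in> X"
      and 1: "i = j \<or> ?P i j \<or> ?Q i j" and 2: "j = k \<or> ?P j k \<or> ?Q j k"
    show "i = k \<or> ?P i k \<or> ?Q i k"
      using 1 2 tr(1)[OF ijk] tr(2)[OF ijk] mixed[OF ijk] mixed[OF ijk(3,2,1)] parallel_over_sym
      by metis
  qed (auto dest: parallel_over_sym)
  have W_0: "N' * W (=) \<le> (N' - 1) * Y\<^sup>2"
    unfolding N'_def W_def Y_def by (rule separated_pairs_sum_le[OF fin]) auto
  have U: "U = q * (1 - p) * W (\<lambda>i j. i = j \<or> ?P i j) + q * p * W (=)
      + (1 - q) * (1 - p) * W (\<lambda>i j. i = j \<or> ?P i j \<or> ?Q i j)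
      + (1 - q) * p * W (\<lambda>i j. i = j \<or> ?Q i j)"
    unfolding W_def U_def sum_distrib_left sum.distrib[symmetric]
  proof (rule sum.cong[OF refl])
    fix i assume i: "i \<in> X"
    have "u r s T i j * (y i * y j) =
       q * (1 - p) * (if i = j \<or> ?P i j then 0 else y i * y j)
       + q * p * (if i = j then 0 else y i * y j)
       + (1 - q) * (1 - p) * (if i = j \<or> ?P i j \<or> ?Q i j then 0 else y i * y j)
       + (1 - q) * p * (if i = j \<or> ?Q i j then 0 else y i * y j)" if "j \<in> X - {i}" for j
      using that by (cases "?P i j"; cases "?Q i j") (auto simp: u_def algebra_simps)
    then show "(\<Sum>j\<in>X - {i}. u r s T i j * (y i * y j)) = (\<Sum>j\<in>X.
       q * (1 - p) * (if i = j \<or> ?P i j then 0 else y i * y j)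
       + q * p * (if i = j then 0 else y i * y j)
       + (1 - q) * (1 - p) * (if i = j \<or> ?P i j \<or> ?Q i j then 0 else y i * y j)
       + (1 - q) * p * (if i = j \<or> ?Q i j then 0 else y i * y j))"
      unfolding sum.remove[OF fin i] by (simp cong: sum.cong_simp)
  qed
  have N': "N' \<ge> 2" using N by (simp add: N'_def)
  have NU: "N' * U \<le> (1 - q * p) * ((N' - 1) * Y\<^sup>2) + q * p * (N' * W (=))"
  proof -
    have "N' * U = q * (1 - p) * (N' * W (\<lambda>i j. i = j \<or> ?P i j)) + q * p * (N' * W (=))
      + (1 - q) * (1 - p) * (N' * W (\<lambda>i j. i = j \<or> ?P i j \<or> ?Q i j))
      + (1 - q) * p * (N' * W (\<lambda>i j. i = j \<or> ?Q i j))"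
      unfolding U by (simp add: algebra_simps)
    also have "\<dots> \<le> q * (1 - p) * ((N' - 1) * Y\<^sup>2) + q * p * (N' * W (=))
      + (1 - q) * (1 - p) * ((N' - 1) * Y\<^sup>2) + (1 - q) * p * ((N' - 1) * Y\<^sup>2)"
      using W_M W_N W_U p q N' by (intro add_mono mult_left_mono) auto
    also have "\<dots> = (1 - q * p) * ((N' - 1) * Y\<^sup>2) + q * p * (N' * W (=))"
      by (simp add: algebra_simps)
    finally show ?thesis .
  qed
  have "N' * (t * U) < (N' - 1) * Y\<^sup>2"
  proof (cases "Y = 0")
    case True
    have "W (=) = (\<Sum>i\<in>X. \<Sum>j\<in>X. y i * y j - (if i = j then (y i)\<^sup>2 else 0))"
      unfolding W_def by (intro sum.cong) (auto simp: power2_eq_square)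
    also have "\<dots> = Y * Y - (\<Sum>i\<in>X. (y i)\<^sup>2)"
      unfolding sum_subtractf using fin by (simp add: Y_def sum_product)
    also have "\<dots> < 0"
    proof -
      obtain i where "i \<in> X" "y i \<noteq> 0" using y by blast
      then have "(\<Sum>i\<in>X. (y i)\<^sup>2) > 0" using fin by (intro sum_pos2[of X i]) auto
      then show ?thesis using True by simp
    qed
    finally have "q * p * (N' * W (=)) < 0" using p q N' by (simp add: mult_less_0_iff zero_less_mult_iff)
    then have "N' * U < 0" using NU True by simp
    then have "t * (N' * U) < 0" using t by (simp add: mult_less_0_iff)
    then show ?thesis using True by (simp add: ac_simps)
  next
    case False
    then have pos: "(N' - 1) * Y\<^sup>2 > 0" using N' by simp
    have "q * p * (N' * W (=)) \<le> q * p * ((N' - 1) * Y\<^sup>2)"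
      using W_0 p q by (intro mult_left_mono) auto
    then have "N' * U \<le> (N' - 1) * Y\<^sup>2" using NU by (simp add: algebra_simps)
    then have "t * (N' * U) \<le> t * ((N' - 1) * Y\<^sup>2)" using t by simp
    also have "\<dots> < (N' - 1) * Y\<^sup>2" using mult_strict_right_mono[OF t(2) pos] by simp
    finally show ?thesis by (simp add: ac_simps)
  qed
  then show ?thesis by (simp add: N'_def U_def Y_def)
qed

text \<open>
  The parameters \<open>p\<close> and \<open>q\<close> deform the indicator of the bases of a morphism: at \<open>p = q = 0\<close> the
  last two factors force \<open>r S = card S\<close> and \<open>s S = R\<close>. Up to rescaling the variables, the
  polynomial for \<open>t = 1\<close> is a homogeneous multivariate Tutte polynomial of the morphism. The
  Gaussian factor in \<open>t\<close> multiplies all ratios of neighbouring weights by \<open>t\<^sup>2\<close> and thus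
  provides strictness. The parameter \<open>R\<close> may exceed \<open>s E\<close>, in which case the weight at \<open>q = 0\<close>
  vanishes; this covers morphisms without bases.
\<close>
definition quotient_weight ::
  "'a set \<Rightarrow> ('a set \<Rightarrow> nat) \<Rightarrow> ('a set \<Rightarrow> nat) \<Rightarrow> nat \<Rightarrow> real \<Rightarrow> real \<Rightarrow> real \<Rightarrow> 'a set \<Rightarrow> real" where
  "quotient_weight E r s R p q t S =
     fact (card E - card S) * t ^ (card S)\<^sup>2 * p ^ (card S - r S) * q ^ (R - s S)"

text \<open>
  The factorials contribute the factor \<open>N / (N - 1)\<close> with \<open>N = card (E - T)\<close>, the inverse of the
  constant gained in \<open>separated_pairs_sum_le\<close>; the Gaussian factor contributes \<open>t\<^sup>2\<close>; the two
  rank functions contribute one factor each if the pair is parallel.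
\<close>
lemma quotient_weight_ratio:
  fixes p q t :: real
  assumes fin: "finite E" and Q: "matroid_quotient E r s"
    and card: "\<And>S. S \<subseteq> E \<Longrightarrow> r S \<le> card S" and R: "s E \<le> R"
    and T: "T \<subseteq> E" and ij: "i \<in> E - T" "j \<in> E - T" "i \<noteq> j"
  shows "(real (card (E - T)) - 1)
      * (quotient_weight E r s R p q t T * quotient_weight E r s R p q t (insert i (insert j T)))
    = real (card (E - T)) * (t\<^sup>2 *
       ((if parallel_over r T i j then p else 1) * (if parallel_over s T i j then q else 1))
      * (quotient_weight E r s R p q t (insert i T) * quotient_weight E r s R p q t (insert j T)))"
proof -
  have r: "rank_function E r" and s: "rank_function E s"
    using Q unfolding matroid_quotient_def by auto
  have finT: "finite T" using T fin finite_subset by blast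
  define k where "k = card T"
  have cT: "card (insert i T) = k + 1" "card (insert j T) = k + 1"
    "card (insert i (insert j T)) = k + 2"
    using ij finT by (auto simp: k_def)
  have "card (insert i (insert j T)) \<le> card E"
    using ij T fin by (intro card_mono) auto
  then obtain m where m: "card E = k + 2 + m" using cT le_Suc_ex by metis
  have N: "card (E - T) = m + 2"
    using card_Diff_subset[OF finT T] m by (simp add: k_def)
  have sub: "insert i (insert j T) \<subseteq> E" using ij T by auto
  have le: "r T \<le> k" "r (insert i T) \<le> k + 1" "r (insert j T) \<le> k + 1"
     "r (insert i (insert j T)) \<le> k + 2"
    using card[of T] card[of "insert i T"] card[of "insert j T"] card[OF sub] cT ij T
    by (auto simp: k_def)
  have sle: "s T \<le> R" "s (insert i T) \<le> R" "s (insert j T) \<le> R"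
     "s (insert i (insert j T)) \<le> R"
    using ij T by (auto intro!: order.trans[OF rank_function_mono[OF s] R])
  have pexp: "(k - r T) + (k + 2 - r (insert i (insert j T)))
      = (k + 1 - r (insert i T)) + (k + 1 - r (insert j T)) + (if parallel_over r T i j then 1 else 0)"
    using rank_sum_parallel[OF r sub] le by linarith
  have qexp: "(R - s T) + (R - s (insert i (insert j T)))
      = (R - s (insert i T)) + (R - s (insert j T)) + (if parallel_over s T i j then 1 else 0)"
    using rank_sum_parallel[OF s sub] sle by linarith
  have P: "p ^ (k - r T) * p ^ (k + 2 - r (insert i (insert j T)))
      = p ^ (k + 1 - r (insert i T)) * p ^ (k + 1 - r (insert j T))
        * (if parallel_over r T i j then p else 1)"
    unfolding power_add[symmetric] pexp by (simp add: power_add)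
  have Q': "q ^ (R - s T) * q ^ (R - s (insert i (insert j T)))
      = q ^ (R - s (insert i T)) * q ^ (R - s (insert j T))
        * (if parallel_over s T i j then q else 1)"
    unfolding power_add[symmetric] qexp by (simp add: power_add)
  have "k\<^sup>2 + (k + 2)\<^sup>2 = 2 + (k + 1)\<^sup>2 + (k + 1)\<^sup>2" by (simp add: power2_eq_square algebra_simps)
  then have t: "t ^ k\<^sup>2 * t ^ (k + 2)\<^sup>2 = t\<^sup>2 * t ^ (k + 1)\<^sup>2 * t ^ (k + 1)\<^sup>2"
    unfolding power_add[symmetric] by simp
  have f: "(real (m + 2) - 1) * (fact (m + 2) * fact m) = real (m + 2) * (fact (m + 1) * fact (m + 1))"
    by (simp add: algebra_simps)
  have ms: "card E - k = m + 2" "card E - (k + 1) = m + 1" "card E - (k + 2) = m"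
    using m by auto
  let ?p0 = "p ^ (k - r T)" and ?p2 = "p ^ (k + 2 - r (insert i (insert j T)))"
  let ?q0 = "q ^ (R - s T)" and ?q2 = "q ^ (R - s (insert i (insert j T)))"
  have "(real (m + 2) - 1) * ((fact (m + 2) * t ^ k\<^sup>2 * ?p0 * ?q0) * (fact m * t ^ (k + 2)\<^sup>2 * ?p2 * ?q2))
    = ((real (m + 2) - 1) * (fact (m + 2) * fact m)) * (t ^ k\<^sup>2 * t ^ (k + 2)\<^sup>2) * (?p0 * ?p2) * (?q0 * ?q2)"
    by (simp only: ac_simps)
  then show ?thesis
    unfolding quotient_weight_def cT N k_def[symmetric] ms f t P Q' by (simp only: ac_simps)
qed

lemma quotient_weight_pos:
  "\<lbrakk>0 < p; 0 < q; 0 < t\<rbrakk> \<Longrightarrow> quotient_weight E r s R p q t S > 0"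
  by (simp add: quotient_weight_def)

lemma quotient_weight_log_concave:
  assumes fin: "finite E" and Q: "matroid_quotient E r s"
    and card: "\<And>S. S \<subseteq> E \<Longrightarrow> r S \<le> card S" and R: "s E \<le> R"
    and p: "0 < p" "p < 1" and q: "0 < q" "q < 1" and t: "0 < t" "t < 1"
  shows "strictly_locally_log_concave E (quotient_weight E r s R p q t)"
  unfolding strictly_locally_log_concave_def
proof (intro allI impI)
  fix T :: "nat set" and x :: "nat \<Rightarrow> real"
  assume A: "T \<subseteq> E \<and> (\<exists>i\<in>E - T. x i \<noteq> 0)"
  define c where "c = quotient_weight E r s R p q t"
  define X where "X = E - T"
  define N where "N = real (card X)"
  define y where "y = (\<lambda>i. c (insert i T) * x i)"
  have cpos: "c S > 0" for S unfolding c_def using p q t by (intro quotient_weight_pos)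
  obtain i0 where i0: "i0 \<in> X" "x i0 \<noteq> 0" using A by (auto simp: X_def)
  have finX: "finite X" using fin by (simp add: X_def)
  have "c T * (\<Sum>i\<in>X. \<Sum>j\<in>X - {i}. c (insert i (insert j T)) * x i * x j) < (\<Sum>i\<in>X. y i)\<^sup>2"
  proof (cases "card X \<ge> 2")
    case False
    moreover have "card X \<noteq> 0" using i0 finX by auto
    ultimately have "card X = 1" by linarith
    then have X: "X = {i0}" using i0(1) by (metis card_1_singletonE singletonD)
    show ?thesis unfolding X using i0 cpos[of "insert i0 T"] by (simp add: y_def)
  next
    case True
    define u where "u = (\<lambda>i j. (if parallel_over r T i j then p else 1)
        * (if parallel_over s T i j then q else 1))"
    have y: "\<exists>i\<in>X. y i \<noteq> 0" using i0 cpos[of "insert i0 T"] by (auto simp: y_def intro!: bexI[of _ i0])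
    have "(N - 1) * (c T * (\<Sum>i\<in>X. \<Sum>j\<in>X - {i}. c (insert i (insert j T)) * x i * x j))
        = (\<Sum>i\<in>X. \<Sum>j\<in>X - {i}. (N - 1) * (c T * c (insert i (insert j T))) * (x i * x j))"
      by (simp add: sum_distrib_left ac_simps)
    also have "\<dots> = (\<Sum>i\<in>X. \<Sum>j\<in>X - {i}. N * (t\<^sup>2 * (u i j * (y i * y j))))"
    proof (intro sum.cong refl)
      fix i j assume "i \<in> X" "j \<in> X - {i}"
      then have "(N - 1) * (c T * c (insert i (insert j T)))
          = N * (t\<^sup>2 * u i j * (c (insert i T) * c (insert j T)))"
        unfolding N_def X_def c_def u_def using A
        by (intro quotient_weight_ratio[OF fin Q card R]) (auto simp: X_def)
      then show "(N - 1) * (c T * c (insert i (insert j T))) * (x i * x j)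
          = N * (t\<^sup>2 * (u i j * (y i * y j)))"
        by (simp add: y_def ac_simps)
    qed
    also have "\<dots> = N * (t\<^sup>2 * (\<Sum>i\<in>X. \<Sum>j\<in>X - {i}. u i j * (y i * y j)))"
      by (simp only: sum_distrib_left)
    also have "\<dots> < (N - 1) * (\<Sum>i\<in>X. y i)\<^sup>2"
      unfolding N_def u_def
    proof (rule quotient_pairs_strict[OF Q finX _ True y p q])
      show "X \<union> T \<subseteq> E" using A by (auto simp: X_def)
      show "0 < t\<^sup>2" "t\<^sup>2 < 1" using t by (auto simp: power_less_one_iff)
    qed
    finally show ?thesis using True by (simp add: N_def)
  qed
  then show "quotient_weight E r s R p q t T * (\<Sum>i\<in>E - T. \<Sum>j\<in>E - T - {i}.
        quotient_weight E r s R p q t (insert i (insert j T)) * x i * x j)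
      < (\<Sum>i\<in>E - T. quotient_weight E r s R p q t (insert i T) * x i)\<^sup>2"
    by (simp add: c_def X_def y_def)
qed

section \<open>Signature\<close>

lemma bil_sum_left: "bil V a (\<lambda>i. \<Sum>j\<in>J. s j * w j i) z = (\<Sum>j\<in>J. s j * bil V a (w j) z)"
proof -
  have "bil V a (\<lambda>i. \<Sum>j\<in>J. s j * w j i) z
      = (\<Sum>i\<in>V. \<Sum>j\<in>J. s j * (w j i * (\<Sum>k\<in>V. a i k * z k)))"
    unfolding bil_sum_rows by (simp add: sum_distrib_right mult.assoc)
  also have "\<dots> = (\<Sum>j\<in>J. \<Sum>i\<in>V. s j * (w j i * (\<Sum>k\<in>V. a i k * z k)))"
    by (rule sum.swap)
  finally show ?thesis by (simp only: bil_sum_rows sum_distrib_left)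
qed

text \<open>
  Gram-Schmidt orthogonalization of the standard basis, starting from \<open>e 0\<close>. The process does
  not break down: all later vectors are orthogonal to \<open>e 0\<close>, hence have negative square.
\<close>
lemma lorentz_form_orthogonal_basis:
  assumes L: "lorentz_form {..<N} a" and N: "N > 0" and a00: "a 0 0 > 0"
  obtains w :: "nat \<Rightarrow> nat \<Rightarrow> real"
  where "\<And>j k. \<lbrakk>j < N; k < N; j \<noteq> k\<rbrakk> \<Longrightarrow> bil {..<N} a (w j) (w k) = 0"
    and "bil {..<N} a (w 0) (w 0) > 0"
    and "\<And>k. \<lbrakk>0 < k; k < N\<rbrakk> \<Longrightarrow> bil {..<N} a (w k) (w k) < 0"
proof -
  let ?B = "bil {..<N} a"
  define e where "e = (\<lambda>k i :: nat. if i = k then 1 else 0 :: real)"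
  note comm = lorentz_form_commute[OF L]
  have ee: "?B (e 0) (e 0) > 0"
  proof -
    have "(\<Sum>k<N. a j k * e 0 j * e 0 k) = (if j = 0 then a 0 0 else 0)" for j
    proof -
      have "(\<Sum>k<N. a j k * e 0 j * e 0 k) = (\<Sum>k<N. if k = 0 then a j 0 * e 0 j else 0)"
        by (intro sum.cong) (auto simp: e_def)
      then show ?thesis using N by (simp add: e_def)
    qed
    then show ?thesis using N a00 by (simp add: bil_def)
  qed
  have "\<exists>w. w 0 = e 0 \<and> (\<forall>j<n. w j j = 1 \<and> (\<forall>i>j. w j i = 0)) \<and>
      (\<forall>j<n. \<forall>k<n. j \<noteq> k \<longrightarrow> ?B (w j) (w k) = 0)" if "0 < n" "n \<le> N" for n
    using that
  proof (induction n rule: nat_induct_non_zero)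
    case 1
    then show ?case by (intro exI[of _ "\<lambda>_. e 0"]) (auto simp: e_def)
  next
    case (Suc n)
    then obtain w where w0: "w 0 = e 0" and wj: "\<And>j. j < n \<Longrightarrow> w j j = 1"
      and wi: "\<And>j i. \<lbrakk>j < n; i > j\<rbrakk> \<Longrightarrow> w j i = 0"
      and orth: "\<And>j k. \<lbrakk>j < n; k < n; j \<noteq> k\<rbrakk> \<Longrightarrow> ?B (w j) (w k) = 0"
      by auto
    have nz: "?B (w j) (w j) \<noteq> 0" if j: "j < n" for j
    proof (cases "j = 0")
      case True
      then show ?thesis using ee w0 by simp
    next
      case False
      have "?B (w j) (w j) < 0"
        by (rule lorentz_form_negative[OF L ee])
          (use False j orth[of j 0] w0 wj[OF j] Suc in \<open>auto intro!: bexI[of _ j]\<close>)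
      then show ?thesis by simp
    qed
    define s where "s = (\<lambda>j. - ?B (e n) (w j) / ?B (w j) (w j))"
    define z where "z = (\<lambda>i. e n i + (\<Sum>j<n. s j * w j i))"
    have zk: "?B z (w k) = 0" if k: "k < n" for k
    proof -
      have "(\<Sum>j<n. s j * ?B (w j) (w k)) = (\<Sum>j<n. if j = k then s k * ?B (w k) (w k) else 0)"
        using k orth by (intro sum.cong) auto
      also have "\<dots> = - ?B (e n) (w k)" using k nz[OF k] by (simp add: s_def)
      finally show ?thesis unfolding z_def bil_add_left bil_sum_left by simp
    qed
    have zi: "z i = e n i" if "i \<ge> n" for i
      unfolding z_def using that wi by (simp add: sum.neutral)
    show ?case
    proof (intro exI[of _ "w(n := z)"] conjI allI impI)
      show "(w(n := z)) 0 = e 0" using Suc w0 by simp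
      show "(w(n := z)) j j = 1" if "j < Suc n" for j
        using that wj zi[of n] by (cases "j = n") (auto simp: e_def)
      show "(w(n := z)) j i = 0" if "j < Suc n" "i > j" for j i
        using that wi zi[of i] by (cases "j = n") (auto simp: e_def)
      show "?B ((w(n := z)) j) ((w(n := z)) k) = 0" if "j < Suc n" "k < Suc n" "j \<noteq> k" for j k
        using that orth zk comm[of _ z] by (cases "j = n"; cases "k = n") auto
    qed
  qed
  from this[OF N order.refl] obtain w where w0: "w 0 = e 0" and wj: "\<And>j. j < N \<Longrightarrow> w j j = 1"
    and orth: "\<And>j k. \<lbrakk>j < N; k < N; j \<noteq> k\<rbrakk> \<Longrightarrow> ?B (w j) (w k) = 0"
    by auto
  have "?B (w k) (w k) < 0" if "0 < k" "k < N" for k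
    by (rule lorentz_form_negative[OF L ee])
      (use that orth[of k 0] w0 wj in \<open>auto intro!: bexI[of _ k]\<close>)
  then show thesis using that[of w] orth ee w0 by auto
qed

text \<open>
  The orthogonal basis forms the columns of the coordinate change. Its invertibility comes for
  free from that of the diagonal matrix.
\<close>
lemma has_signature_lorentz_form:
  assumes L: "lorentz_form {..<N} (\<lambda>i j. quad_form_mat N q $$ (i, j))"
    and N: "N > 0" and pos: "quad_form_mat N q $$ (0, 0) > 0"
  shows "has_signature N q 1 (N - 1)"
proof -
  define G where "G = quad_form_mat N q"
  have G: "G \<in> carrier_mat N N" by (simp add: G_def quad_form_mat_def)
  let ?B = "bil {..<N} (\<lambda>i j. G $$ (i, j))"
  obtain w where orth: "\<And>j k. \<lbrakk>j < N; k < N; j \<noteq> k\<rbrakk> \<Longrightarrow> ?B (w j) (w k) = 0"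
    and w0: "?B (w 0) (w 0) > 0" and wk: "\<And>k. \<lbrakk>0 < k; k < N\<rbrakk> \<Longrightarrow> ?B (w k) (w k) < 0"
    using lorentz_form_orthogonal_basis[OF L N pos] unfolding G_def by blast
  define P where "P = Matrix.mat N N (\<lambda>(i, j). w j i)"
  define D where "D = (\<lambda>j. ?B (w j) (w j))"
  have P: "P \<in> carrier_mat N N" by (simp add: P_def)
  have Dnz: "D j \<noteq> 0" if "j < N" for j
    using that w0 wk[of j] unfolding D_def by (cases "j = 0") auto
  have PGP: "transpose_mat P * G * P = mat_diag N D"
  proof (rule eq_matI)
    fix i j assume "i < dim_row (mat_diag N D)" "j < dim_col (mat_diag N D)"
    then have ij: "i < N" "j < N" by (auto simp: mat_diag_def)
    have "(transpose_mat P * G * P) $$ (i, j)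
        = (\<Sum>k\<in>{0..<N}. (\<Sum>l\<in>{0..<N}. w i l * G $$ (l, k)) * w j k)"
      using ij G by (simp add: P_def scalar_prod_def)
    also have "\<dots> = (\<Sum>k\<in>{0..<N}. \<Sum>l\<in>{0..<N}. G $$ (l, k) * w i l * w j k)"
      by (simp add: sum_distrib_right sum_distrib_left ac_simps)
    also have "\<dots> = (\<Sum>l\<in>{0..<N}. \<Sum>k\<in>{0..<N}. G $$ (l, k) * w i l * w j k)"
      by (rule sum.swap)
    also have "\<dots> = ?B (w i) (w j)" by (simp add: bil_def atLeast0LessThan)
    finally show "(transpose_mat P * G * P) $$ (i, j) = mat_diag N D $$ (i, j)"
      using ij orth by (simp add: mat_diag_def D_def)
  qed (auto simp: P_def mat_diag_def)
  have inv: "invertible_mat P"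
  proof -
    define X where "X = mat_diag N (\<lambda>j. 1 / D j) * (transpose_mat P * G)"
    have X: "X \<in> carrier_mat N N" unfolding X_def using P G by (intro mult_carrier_mat[of _ N N]) auto
    have "X * P = mat_diag N (\<lambda>j. 1 / D j) * (transpose_mat P * G * P)"
      unfolding X_def using P G by (intro assoc_mult_mat[of _ N N _ N _ N]) auto
    also have "\<dots> = 1\<^sub>m N"
      unfolding PGP mat_diag_mult_left[OF mat_diag_dim]
      using Dnz by (intro eq_matI) (auto simp: mat_diag_def)
    finally have XP: "X * P = 1\<^sub>m N" .
    have "P * X = 1\<^sub>m N" by (rule mat_mult_left_right_inverse[OF X P XP])
    with XP show ?thesis
      using P X unfolding invertible_mat_def inverts_mat_def by (auto intro!: exI[of _ X])
  qed
  have "{i. i < N \<and> D i > 0} = {0}"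
    using N w0 wk unfolding D_def by (auto simp: not_less_iff_gr_or_eq) (metis gr0I less_asym)
  moreover have "{i. i < N \<and> D i < 0} = {1..<N}"
    using w0 wk unfolding D_def by (auto simp: Suc_le_eq) (metis gr0I less_asym)
  ultimately show ?thesis
    unfolding has_signature_def using P inv PGP[unfolded G_def] by (intro exI[of _ P] exI[of _ D]) auto
qed

section \<open>Strictly Lorentzian polynomials by perturbation\<close>

definition mon :: "nat multiset \<Rightarrow> monom" where
  "mon M = (\<Sum>i\<in>#M. Poly_Mapping.single i 1)"

definition mset_of_monom :: "nat \<Rightarrow> monom \<Rightarrow> nat multiset" where
  "mset_of_monom N \<alpha> = (\<Sum>i<N. replicate_mset (Poly_Mapping.lookup \<alpha> i) i)"

definition mfact :: "nat \<Rightarrow> nat multiset \<Rightarrow> real" where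
  "mfact N M = (\<Prod>i<N. fact (count M i))"

lemma mon_add_mset: "mon (add_mset i M) = mon M + Poly_Mapping.single i 1"
  by (simp add: mon_def add.commute)

lemma lookup_mon: "Poly_Mapping.lookup (mon M) i = count M i"
  by (induction M) (auto simp: mon_add_mset lookup_add lookup_single when_def mon_def[of "{#}"])

lemma mon_eq_iff: "mon M = mon M' \<longleftrightarrow> M = M'"
  by (metis lookup_mon multiset_eqI)

lemma count_mset_of_monom:
  "count (mset_of_monom N \<alpha>) i = (if i < N then Poly_Mapping.lookup \<alpha> i else 0)"
proof -
  have "count (mset_of_monom N \<alpha>) i = (\<Sum>k<N. if k = i then Poly_Mapping.lookup \<alpha> i else 0)"
    unfolding mset_of_monom_def count_sum by (intro sum.cong) auto
  then show ?thesis by simp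
qed

lemma set_mset_of_monom: "set_mset (mset_of_monom N \<alpha>) \<subseteq> {..<N}"
  by (auto simp: count_greater_zero_iff[symmetric] count_mset_of_monom simp del: count_greater_zero_iff split: if_splits)

lemma mset_of_monom_mon: "set_mset M \<subseteq> {..<N} \<Longrightarrow> mset_of_monom N (mon M) = M"
  by (rule multiset_eqI) (auto simp: count_mset_of_monom lookup_mon not_in_iff[symmetric])

lemma monoms_of_eq: "monoms_of N d = mon ` {M. set_mset M \<subseteq> {..<N} \<and> size M = d}"
proof (intro equalityI subsetI)
  fix \<alpha> assume \<alpha>: "\<alpha> \<in> monoms_of N d"
  have "mon (mset_of_monom N \<alpha>) = \<alpha>"
    using \<alpha> by (intro poly_mapping_eqI)
      (auto simp: lookup_mon count_mset_of_monom monoms_of_def in_keys_iff subset_iff)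
  moreover have "size (mset_of_monom N \<alpha>) = d"
    using \<alpha> by (simp add: mset_of_monom_def monoms_of_def size_mset_sum_mset_conv)
  ultimately show "\<alpha> \<in> mon ` {M. set_mset M \<subseteq> {..<N} \<and> size M = d}"
    using set_mset_of_monom[of N \<alpha>] by (auto intro!: image_eqI[of _ _ "mset_of_monom N \<alpha>"])
next
  fix \<alpha> assume "\<alpha> \<in> mon ` {M. set_mset M \<subseteq> {..<N} \<and> size M = d}"
  then obtain M where M: "\<alpha> = mon M" "set_mset M \<subseteq> {..<N}" "size M = d" by auto
  have "(\<Sum>i<N. count M i) = size M"
    unfolding size_multiset_overloaded_eq
    by (rule sum.mono_neutral_right) (use M in \<open>auto simp: not_in_iff\<close>)
  moreover have "Poly_Mapping.keys (mon M) \<subseteq> {..<N}"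
    using M(2) by (auto simp: in_keys_iff lookup_mon not_in_iff[symmetric])
  ultimately show "\<alpha> \<in> monoms_of N d" using M by (simp add: monoms_of_def lookup_mon)
qed

lemma finite_monoms_of: "finite (monoms_of N d)"
proof -
  have "{M. set_mset M \<subseteq> {..<N} \<and> size M = d} \<subseteq> mset ` {xs. set xs \<subseteq> {..<N} \<and> length xs = d}"
  proof
    fix M assume M: "M \<in> {M. set_mset M \<subseteq> {..<N} \<and> size M = d}"
    obtain xs where "mset xs = M" using ex_mset by blast
    then show "M \<in> mset ` {xs. set xs \<subseteq> {..<N} \<and> length xs = d}" using M by force
  qed
  then have "finite {M. set_mset M \<subseteq> {..<N} \<and> size M = d}"
    by (rule finite_subset) (simp add: finite_lists_length_eq)
  then show ?thesis unfolding monoms_of_eq by (rule finite_imageI)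
qed

lemma mfact_add_mset: "i < N \<Longrightarrow> mfact N (add_mset i M) = real (count M i + 1) * mfact N M"
proof -
  assume i: "i < N"
  have "(\<Prod>j\<in>{..<N} - {i}. fact (count (add_mset i M) j))
      = (\<Prod>j\<in>{..<N} - {i}. fact (count M j) :: real)"
    by (intro prod.cong) auto
  then show ?thesis
    using i unfolding mfact_def by (simp add: prod.remove[of "{..<N}" i] mult.assoc)
qed

lemma mfact_pos: "mfact N M > 0"
  unfolding mfact_def by (intro prod_pos) auto

text \<open>
  The factorials turn a coefficient into the corresponding derivative, so that a partial
  derivative of the polynomial simply adds an index to its tensor.
\<close>
definition deriv_tensor :: "nat \<Rightarrow> rpoly \<Rightarrow> nat multiset \<Rightarrow> real" where
  "deriv_tensor N h M = mfact N M * Poly_Mapping.lookup h (mon M)"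

lemma deriv_tensor_partial_deriv:
  "i < N \<Longrightarrow> deriv_tensor N (partial_deriv i h) M = deriv_tensor N h (add_mset i M)"
  by (simp add: deriv_tensor_def lookup_partial_deriv mfact_add_mset mon_add_mset lookup_mon)

lemma deriv_tensor_foldr:
  "set is \<subseteq> {..<N} \<Longrightarrow>
    deriv_tensor N (foldr partial_deriv is h) M = deriv_tensor N h (mset is + M)"
  by (induction "is" arbitrary: M) (auto simp: deriv_tensor_partial_deriv)

lemma quad_form_mat_deriv_tensor:
  assumes "i < N" "j < N"
  shows "quad_form_mat N q $$ (i, j) = deriv_tensor N q {#i, j#} / 2"
proof -
  have m: "mon {#i, j#} = Poly_Mapping.single i 1 + Poly_Mapping.single j 1"
    by (simp add: mon_def)
  have "mfact N {#i, j#} = (if i = j then 2 else 1)"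
    using assms by (simp add: mfact_add_mset mfact_def[of N "{#}"])
  then show ?thesis
    using assms by (simp add: quad_form_mat_def deriv_tensor_def m Let_def)
qed

text \<open>
  Taylor's formula: the polynomial with prescribed derivatives of order \<open>d\<close>.
\<close>
definition tensor_poly :: "nat \<Rightarrow> nat \<Rightarrow> (nat multiset \<Rightarrow> real) \<Rightarrow> rpoly" where
  "tensor_poly N d S =
     (\<Sum>\<alpha>\<in>monoms_of N d.
        Poly_Mapping.single \<alpha> (S (mset_of_monom N \<alpha>) / mfact N (mset_of_monom N \<alpha>)))"

lemma lookup_tensor_poly:
  "Poly_Mapping.lookup (tensor_poly N d S) \<alpha> =
    (if \<alpha> \<in> monoms_of N d then S (mset_of_monom N \<alpha>) / mfact N (mset_of_monom N \<alpha>) else 0)"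
  unfolding tensor_poly_def lookup_sum lookup_single
  using finite_monoms_of[of N d] by (simp add: when_def)

lemma homogeneous_tensor_poly: "homogeneous N d (tensor_poly N d S)"
  unfolding homogeneous_def by (auto simp: in_keys_iff lookup_tensor_poly split: if_splits)

lemma deriv_tensor_tensor_poly:
  assumes "set_mset M \<subseteq> {..<N}" "size M = d"
  shows "deriv_tensor N (tensor_poly N d S) M = S M"
proof -
  have "mon M \<in> monoms_of N d" using assms unfolding monoms_of_eq by auto
  then show ?thesis
    using mfact_pos[of N M] by (simp add: deriv_tensor_def lookup_tensor_poly mset_of_monom_mon[OF assms(1)])
qed

lemma foldr_dird_cong_mset:
  assumes "mset vs = mset vs'"
  shows "foldr (dird V) vs T = foldr (dird V) vs' T"
proof -
  have "fold (dird V) (rev vs) = fold (dird V) (rev vs')"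
    by (rule fold_multiset_equiv) (auto simp: dird_commute assms)
  then show ?thesis by (simp add: foldr_conv_fold)
qed

text \<open>
  An injective substitution suffices: a vector whose image is orthogonal to that of \<open>u\<close> has
  nonzero image, which has negative square.
\<close>
lemma lorentz_form_pullback:
  assumes L: "lorentz_form V a" and u: "bil W b u u > 0"
    and b: "\<And>x y. bil W b x y = s * bil V a (A x) (A y)" and s: "s > 0"
    and sym: "\<And>j k. \<lbrakk>j \<in> W; k \<in> W\<rbrakk> \<Longrightarrow> b j k = b k j"
    and inj: "\<And>x. \<exists>i\<in>W. x i \<noteq> 0 \<Longrightarrow> \<exists>i\<in>V. A x i \<noteq> 0"
  shows "lorentz_form W b"
proof -
  have "bil V a (A u) (A u) > 0" using u s unfolding b by (simp add: zero_less_mult_iff)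
  then have "bil V a (A x) (A x) < 0" if "bil V a (A x) (A u) = 0" "\<exists>i\<in>W. x i \<noteq> 0" for x
    using that by (intro lorentz_form_negative[OF L] inj)
  then have "bil W b x x < 0" if "bil W b x u = 0" "\<exists>i\<in>W. x i \<noteq> 0" for x
    using that s unfolding b by (auto simp: mult_less_0_iff)
  then show ?thesis unfolding lorentz_form_def using sym u by blast
qed

text \<open>
  The rows of the identity matrix plus \<open>\<epsilon>\<close> times the all-ones matrix. Substituting these
  strictly positive linear forms for the variables creates all monomials of the given degree,
  and the derivatives of the new polynomial in the coordinate directions are those of the old
  one in strictly positive directions. The tensor of the new polynomial is \<open>perturb\<close>.
\<close>
definition near_id :: "real \<Rightarrow> nat \<Rightarrow> nat \<Rightarrow> real" where
  "near_id \<epsilon> i k = (if k = i then 1 else 0) + \<epsilon>"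

definition perturb :: "nat set \<Rightarrow> real \<Rightarrow> (nat multiset \<Rightarrow> real) \<Rightarrow> nat multiset \<Rightarrow> real" where
  "perturb V \<epsilon> T M = foldr (dird V) (map (near_id \<epsilon>) (sorted_list_of_multiset M)) T {#}"

lemma perturb_mset: "perturb V \<epsilon> T (mset is) = foldr (dird V) (map (near_id \<epsilon>) is) T {#}"
proof -
  have "mset (map (near_id \<epsilon>) (sorted_list_of_multiset (mset is))) = mset (map (near_id \<epsilon>) is)"
    by (simp only: mset_map mset_sorted_list_of_multiset)
  from foldr_dird_cong_mset[OF this] show ?thesis unfolding perturb_def by metis
qed

text \<open>
  The Hessians are the forms of \<open>lorentz_form_dird\<close>, pulled back along an invertible matrix.
\<close>
lemma strictly_lorentzian_perturb:
  fixes c :: "nat set \<Rightarrow> real"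
  assumes cpos: "\<And>S. S \<subseteq> {1..n} \<Longrightarrow> c S > 0"
    and local: "strictly_locally_log_concave {1..n} c" and \<epsilon>: "\<epsilon> > 0"
  shows "strictly_lorentzian (n + 1) d (tensor_poly (n + 1) d (perturb {..<n + 1} \<epsilon> (sq_tensor c)))"
proof -
  define V where "V = {..<n + 1}"
  have V: "V = insert 0 {1..n}" by (auto simp: V_def)
  have fin: "finite V" by (simp add: V_def)
  let ?a = "near_id \<epsilon>"
  have apos: "?a i k > 0" for i k using \<epsilon> by (simp add: near_id_def)
  have P: "perturb V \<epsilon> (sq_tensor c) M > 0" for M
    unfolding perturb_def
    by (rule foldr_dird_sq_tensor_pos) (use fin apos cpos in \<open>auto simp: V\<close>)
  define g where "g = tensor_poly (n + 1) d (perturb V \<epsilon> (sq_tensor c))"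
  have "has_signature (n + 1) (foldr partial_deriv is g) 1 (n + 1 - 1)"
    if len: "length is + 2 = d" and sub: "set is \<subseteq> {..<n + 1}" for "is"
  proof -
    define F where "F = foldr (dird V) (map ?a is) (sq_tensor c)"
    define B where "B = (\<lambda>j k. F {#j, k#})"
    have LB: "lorentz_form V B"
      unfolding B_def F_def V
      by (rule lorentz_form_dird) (use cpos local apos in auto)
    define G where "G = (\<lambda>j k. quad_form_mat (n + 1) (foldr partial_deriv is g) $$ (j, k))"
    have G_perturb: "G j k = perturb V \<epsilon> (sq_tensor c) (mset (j # k # is)) / 2"
      if "j \<in> V" "k \<in> V" for j k
    proof -
      have "G j k = deriv_tensor (n + 1) g (mset is + {#j, k#}) / 2"
        using that sub unfolding G_def V_def by (simp add: quad_form_mat_deriv_tensor deriv_tensor_foldr)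
      also have "\<dots> = perturb V \<epsilon> (sq_tensor c) (mset is + {#j, k#}) / 2"
        unfolding g_def using that sub len by (subst deriv_tensor_tensor_poly) (auto simp: V_def)
      finally show ?thesis by simp
    qed
    have G: "G j k = (\<Sum>p\<in>V. \<Sum>r\<in>V. B p r * ?a j p * ?a k r) / 2" if "j \<in> V" "k \<in> V" for j k
      unfolding G_perturb[OF that] perturb_mset list.map foldr_dird_Cons F_def[symmetric] B_def
      by (simp add: sum_distrib_left add_mset_commute ac_simps)
    define A where "A = (\<lambda>x p. \<Sum>j\<in>V. x j * ?a j p)"
    have bilG: "bil V G x y = 1 / 2 * bil V B (A x) (A y)" for x y
    proof -
      have right: "bil V B z (A y) = (\<Sum>k\<in>V. y k * bil V B z (?a k))" for z
      proof -
        have "bil V B z (A y) = (\<Sum>k\<in>V. y k * bil V B (?a k) z)"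
          unfolding lorentz_form_commute[OF LB, of z] A_def by (rule bil_sum_left)
        then show ?thesis by (simp only: lorentz_form_commute[OF LB, of z])
      qed
      have "bil V B (A x) (A y) = (\<Sum>j\<in>V. x j * bil V B (?a j) (A y))"
        unfolding A_def by (rule bil_sum_left)
      also have "\<dots> = (\<Sum>j\<in>V. x j * (\<Sum>k\<in>V. y k * bil V B (?a j) (?a k)))"
        by (simp only: right)
      also have "\<dots> = (\<Sum>j\<in>V. x j * (\<Sum>k\<in>V. y k * (2 * G j k)))"
        by (intro sum.cong refl arg_cong2[where f = "(*)"]) (simp add: G bil_def)
      finally show ?thesis by (simp add: bil_def sum_distrib_left ac_simps)
    qed
    have pos: "G 0 0 > 0" using P by (simp add: G_perturb V)
    have "lorentz_form V G"
    proof (rule lorentz_form_pullback[OF LB _ bilG])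
      show "bil V G (\<lambda>i. if i = 0 then 1 else 0) (\<lambda>i. if i = 0 then 1 else 0) > 0"
      proof -
        have "(\<Sum>k\<in>V. G j k * (if j = 0 then 1 else 0) * (if k = 0 then 1 else 0)) = (if j = 0 then G 0 0 else 0)" for j
          unfolding V by simp
        then show ?thesis unfolding bil_def using pos fin V by simp
      qed
      show "G j k = G k j" if "j \<in> V" "k \<in> V" for j k
        using that by (simp add: G_perturb add_mset_commute)
      show "\<exists>i\<in>V. A x i \<noteq> 0" if x: "\<exists>i\<in>V. x i \<noteq> 0" for x
      proof (rule ccontr)
        assume "\<not> ?thesis"
        then have A0: "A x i = 0" if "i \<in> V" for i using that by blast
        define \<sigma> where "\<sigma> = (\<Sum>j\<in>V. x j)"
        have A: "A x i = x i + \<epsilon> * \<sigma>" if "i \<in> V" for i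
        proof -
          have "A x i = (\<Sum>j\<in>V. if j = i then x j else 0) + (\<Sum>j\<in>V. \<epsilon> * x j)"
            unfolding A_def sum.distrib[symmetric]
            by (intro sum.cong) (auto simp: near_id_def algebra_simps)
          then show ?thesis using that fin by (simp add: \<sigma>_def sum_distrib_left)
        qed
        have "0 = (\<Sum>i\<in>V. A x i)" using A0 by simp
        also have "\<dots> = \<sigma> * (1 + real (card V) * \<epsilon>)"
          by (simp add: A sum.distrib \<sigma>_def[symmetric] algebra_simps)
        finally have "\<sigma> = 0" using \<epsilon> by (auto simp: add_pos_nonneg[THEN less_imp_neq, symmetric])
        then show False using x A A0 by auto
      qed
    qed simp
    then show ?thesis
      using pos unfolding G_def V_def by (intro has_signature_lorentz_form) auto
  qed
  moreover have "Poly_Mapping.lookup g \<alpha> > 0" if "\<alpha> \<in> monoms_of (n + 1) d" for \<alpha>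
    using that P mfact_pos by (simp add: g_def lookup_tensor_poly)
  ultimately show ?thesis
    using homogeneous_tensor_poly unfolding strictly_lorentzian_def g_def V_def by blast
qed

lemma perturb_tendsto:
  assumes fin: "finite V" and T: "\<And>M. (\<lambda>k. T k M) \<longlonglongrightarrow> T' M" and \<epsilon>: "\<epsilon> \<longlonglongrightarrow> 0"
    and M: "set_mset M \<subseteq> V"
  shows "(\<lambda>k::nat. perturb V (\<epsilon> k) (T k) M) \<longlonglongrightarrow> T' M"
proof -
  have "(\<lambda>k. foldr (dird V) (map (near_id (\<epsilon> k)) is) (T k) M) \<longlonglongrightarrow> T' (mset is + M)"
    if "set is \<subseteq> V" for "is" M
    using that
  proof (induction "is" arbitrary: M)
    case Nil
    then show ?case using T by simp
  next
    case (Cons i "is")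
    let ?F = "\<lambda>k. foldr (dird V) (map (near_id (\<epsilon> k)) is) (T k)"
    have id: "(\<lambda>k. near_id (\<epsilon> k) i p) \<longlonglongrightarrow> (if p = i then 1 else 0) + 0" for p
      unfolding near_id_def by (intro tendsto_intros \<epsilon>)
    have "(\<lambda>k. \<Sum>p\<in>V. near_id (\<epsilon> k) i p * ?F k (add_mset p M))
        \<longlonglongrightarrow> (\<Sum>p\<in>V. ((if p = i then 1 else 0) + 0) * T' (mset is + add_mset p M))"
      using Cons.prems by (intro tendsto_sum tendsto_mult id Cons.IH) auto
    moreover have "(\<Sum>p\<in>V. ((if p = i then 1 else 0) + 0) * T' (mset is + add_mset p M))
        = (\<Sum>p\<in>V. if p = i then T' (mset is + add_mset p M) else 0)"
      by (intro sum.cong) auto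
    ultimately show ?case
      using Cons.prems fin by (simp only: list.map foldr_dird_Cons) simp
  qed
  from this[of "sorted_list_of_multiset M" "{#}"] M show ?thesis by (simp add: perturb_def)
qed

section \<open>Bases of a morphism\<close>

lemma matroid_mono: "\<lbrakk>matroid E r; S \<subseteq> T; T \<subseteq> E\<rbrakk> \<Longrightarrow> r S \<le> r T"
  unfolding matroid_def by blast

lemma matroid_rank_le_card: "\<lbrakk>matroid E r; S \<subseteq> E\<rbrakk> \<Longrightarrow> r S \<le> card S"
  unfolding matroid_def by blast

lemma matroid_submodular:
  "\<lbrakk>matroid E r; S \<subseteq> E; T \<subseteq> E\<rbrakk> \<Longrightarrow> r (S \<union> T) + r (S \<inter> T) \<le> r S + r T"
  unfolding matroid_def by blast

lemma matroid_finite: "matroid E r \<Longrightarrow> finite E"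
  unfolding matroid_def by blast

lemma matroid_insert_le:
  assumes M: "matroid E r" and sub: "insert i S \<subseteq> E"
  shows "r (insert i S) \<le> r S + 1"
proof -
  have "{i} \<subseteq> E" "S \<subseteq> E" using sub by auto
  then have "r ({i} \<union> S) + r ({i} \<inter> S) \<le> r {i} + r S" "r {i} \<le> card {i}"
    by (rule matroid_submodular[OF M], intro matroid_rank_le_card[OF M])
  then show ?thesis by simp
qed

lemma matroid_independent_subset:
  assumes M: "matroid E r" and B: "B \<subseteq> E" "r B = card B" and S: "S \<subseteq> B"
  shows "r S = card S"
proof -
  have finB: "finite B" using matroid_finite[OF M] B(1) finite_subset by blast
  have "B - S \<subseteq> E" "S \<subseteq> E" using B S by auto
  have "r (S \<union> (B - S)) + r (S \<inter> (B - S)) \<le> r S + r (B - S)"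
    by (rule matroid_submodular[OF M \<open>S \<subseteq> E\<close> \<open>B - S \<subseteq> E\<close>])
  moreover have "r (B - S) \<le> card (B - S)" "r S \<le> card S"
    by (rule matroid_rank_le_card[OF M], fact)+
  moreover have "S \<union> (B - S) = B" using S by auto
  moreover have "card (B - S) + card S = card B"
    using S finB by (metis card_Diff_subset card_mono finite_subset le_add_diff_inverse2)
  ultimately show ?thesis using B(2) by simp
qed

text \<open>
  Take a maximal independent set between \<open>S\<close> and \<open>X\<close>. No single element increases its rank,
  hence by submodularity neither does all of \<open>X\<close>.
\<close>
lemma matroid_extend_independent:
  assumes M: "matroid E r" and S: "S \<subseteq> X" "r S = card S" and X: "X \<subseteq> E"
  obtains B where "S \<subseteq> B" "B \<subseteq> X" "r B = card B" "r B = r X"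
proof -
  have finX: "finite X" using matroid_finite[OF M] X finite_subset by blast
  define I where "I = {B. S \<subseteq> B \<and> B \<subseteq> X \<and> r B = card B}"
  have "finite I" unfolding I_def using finX by (auto intro: finite_subset[of _ "Pow X"])
  moreover have "S \<in> I" using S by (simp add: I_def)
  ultimately obtain B where B: "B \<in> I" and max: "\<And>C. \<lbrakk>C \<in> I; B \<subseteq> C\<rbrakk> \<Longrightarrow> C = B"
    using finite_has_maximal[of I] by (metis empty_iff)
  have BX: "S \<subseteq> B" "B \<subseteq> X" "r B = card B" using B by (auto simp: I_def)
  have finB: "finite B" using BX finX finite_subset by blast
  have stuck: "r (insert e B) = r B" if e: "e \<in> X" for e
  proof (rule ccontr)
    assume ne: "r (insert e B) \<noteq> r B"
    then have "e \<notin> B" by (auto simp: insert_absorb)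
    have "r B \<le> r (insert e B)" using e BX X by (intro matroid_mono[OF M]) auto
    moreover have "r (insert e B) \<le> r B + 1" using e BX X by (intro matroid_insert_le[OF M]) auto
    ultimately have "r (insert e B) = card (insert e B)"
      using ne BX \<open>e \<notin> B\<close> finB by simp
    then have "insert e B \<in> I" using e BX by (auto simp: I_def)
    from max[OF this] show False using \<open>e \<notin> B\<close> by blast
  qed
  have "r (B \<union> Y) = r B" if "finite Y" "Y \<subseteq> X" for Y
    using that
  proof (induction Y rule: finite_induct)
    case (insert e Y)
    have sub: "B \<union> Y \<subseteq> E" "insert e B \<subseteq> E" using insert.prems BX X by auto
    have "r ((B \<union> Y) \<union> insert e B) + r ((B \<union> Y) \<inter> insert e B) \<le> r (B \<union> Y) + r (insert e B)"
      by (rule matroid_submodular[OF M sub])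
    moreover have "r B \<le> r ((B \<union> Y) \<inter> insert e B)"
      using sub by (intro matroid_mono[OF M]) auto
    moreover have "(B \<union> Y) \<union> insert e B = B \<union> insert e Y" by auto
    moreover have "r B \<le> r (B \<union> insert e Y)"
      using insert.prems BX X by (intro matroid_mono[OF M]) auto
    ultimately show ?case using insert stuck[of e] by auto
  qed simp
  from this[OF finX] have "r X = r B" using BX by (simp add: Un_absorb1)
  then show thesis using that BX by metis
qed

text \<open>
  Independent sets are exactly the subsets of bases, and the sets of full rank are exactly those
  containing a basis.
\<close>
lemma morphism_bases_iff:
  fixes f :: "'a \<Rightarrow> 'b"
  assumes M: "matroid E r" and N: "matroid F s" and f: "f ` E \<subseteq> F"
  shows "S \<in> morphism_bases E r F s f \<longleftrightarrow> S \<subseteq> E \<and> r S = card S \<and> s (f ` S) = s F"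
proof (intro iffI conjI)
  assume S: "S \<in> morphism_bases E r F s f"
  then obtain B C where B: "matroid_basis E r B" "S \<subseteq> B" and C: "matroid_basis F s C" "C \<subseteq> f ` S"
    and SE: "S \<subseteq> E"
    unfolding morphism_bases_def by blast
  show "S \<subseteq> E" by (rule SE)
  have "B \<subseteq> E" "r B = card B" using B(1) unfolding matroid_basis_def by blast+
  then show "r S = card S" by (rule matroid_independent_subset[OF M _ _ B(2)])
  have fS: "f ` S \<subseteq> F" using SE f by auto
  have "s C = s F" using C(1) unfolding matroid_basis_def by metis
  moreover have "s C \<le> s (f ` S)" by (rule matroid_mono[OF N C(2) fS])
  moreover have "s (f ` S) \<le> s F" by (rule matroid_mono[OF N fS order.refl])
  ultimately show "s (f ` S) = s F" by simp
next
  assume S: "S \<subseteq> E \<and> r S = card S \<and> s (f ` S) = s F"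
  obtain B where "S \<subseteq> B" "B \<subseteq> E" "r B = card B" "r B = r E"
    using matroid_extend_independent[OF M, of S E] S by auto
  then have "\<exists>B. matroid_basis E r B \<and> S \<subseteq> B" unfolding matroid_basis_def by metis
  moreover have fS: "f ` S \<subseteq> F" using S f by auto
  have "s {} = card ({} :: 'b set)" using matroid_rank_le_card[OF N, of "{}"] by simp
  then obtain C where "C \<subseteq> f ` S" "s C = card C" "s C = s (f ` S)"
    using matroid_extend_independent[OF N, of "{}" "f ` S"] fS by auto
  then have "matroid_basis F s C \<and> C \<subseteq> f ` S"
    using S fS unfolding matroid_basis_def by (metis subset_trans)
  then have "\<exists>C. matroid_basis F s C \<and> C \<subseteq> f ` S" by blast
  ultimately show "S \<in> morphism_bases E r F s f"
    using S unfolding morphism_bases_def by blast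
qed

lemma morphism_quotient:
  assumes "matroid_morphism E r F s f"
  shows "matroid_quotient E r (\<lambda>S. s (f ` S))"
proof -
  have M: "matroid E r" and N: "matroid F s" and f: "f ` E \<subseteq> F"
    and q: "\<And>S1 S2. \<lbrakk>S1 \<subseteq> S2; S2 \<subseteq> E\<rbrakk> \<Longrightarrow>
      int (s (f ` S2)) - int (s (f ` S1)) \<le> int (r S2) - int (r S1)"
    using assms unfolding matroid_morphism_def by auto
  have "rank_function E r"
    unfolding rank_function_def
    by (intro conjI allI impI)
      (simp_all only: matroid_mono[OF M] matroid_submodular[OF M] matroid_insert_le[OF M])
  moreover have "rank_function E (\<lambda>S. s (f ` S))"
    unfolding rank_function_def
  proof (intro conjI allI impI)
    fix S T assume ST: "S \<subseteq> E \<and> T \<subseteq> E"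
    then have sub: "f ` S \<subseteq> F" "f ` T \<subseteq> F" using f by auto
    have "s (f ` (S \<inter> T)) \<le> s (f ` S \<inter> f ` T)"
      using sub by (intro matroid_mono[OF N]) auto
    moreover have "s (f ` S \<union> f ` T) + s (f ` S \<inter> f ` T) \<le> s (f ` S) + s (f ` T)"
      by (rule matroid_submodular[OF N sub])
    ultimately show "s (f ` (S \<union> T)) + s (f ` (S \<inter> T)) \<le> s (f ` S) + s (f ` T)"
      by (simp add: image_Un)
  next
    show "s (f ` S) \<le> s (f ` T)" if "S \<subseteq> T \<and> T \<subseteq> E" for S T
      using that f by (intro matroid_mono[OF N]) auto
    show "s (f ` insert i S) \<le> s (f ` S) + 1" if "insert i S \<subseteq> E" for i S
      using that f matroid_insert_le[OF N, of "f i" "f ` S"] by auto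
  qed
  moreover have "s (f ` T) + r S \<le> r T + s (f ` S)" if "S \<subseteq> T" "T \<subseteq> E" for S T
    using q[OF that] by linarith
  ultimately show ?thesis unfolding matroid_quotient_def by simp
qed

section \<open>The basis generating polynomial as a limit\<close>

text \<open>
  The exponents of the monomial of \<open>S\<close>, homogenized by \<open>w\<^sub>0\<close> to degree \<open>n\<close>.
\<close>
definition hom_mset :: "nat \<Rightarrow> nat set \<Rightarrow> nat multiset" where
  "hom_mset n S = replicate_mset (n - card S) 0 + mset_set S"

lemma monomial_of_set:
  assumes "finite S"
  shows "var 0 ^ k * (\<Prod>i\<in>S. var i) = Poly_Mapping.single (mon (replicate_mset k 0 + mset_set S)) 1"
proof -
  have p: "var 0 ^ k = Poly_Mapping.single (mon (replicate_mset k 0)) 1"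
    by (induction k) (simp_all add: mon_def mult_single var_def)
  have q: "(\<Prod>i\<in>S. var i) = Poly_Mapping.single (mon (mset_set S)) 1"
    using assms by (induction S rule: finite_induct) (simp_all add: mon_def mult_single var_def)
  show ?thesis unfolding p q mult_single by (simp add: mon_def)
qed

lemma hom_mset_monoms_of:
  assumes "S \<subseteq> {1..n}"
  shows "mon (hom_mset n S) \<in> monoms_of (n + 1) n"
proof -
  have fin: "finite S" using assms finite_subset by blast
  have "card S \<le> n" using card_mono[OF _ assms] by simp
  then have "size (hom_mset n S) = n" by (simp add: hom_mset_def)
  moreover have "set_mset (hom_mset n S) \<subseteq> {..<n + 1}"
    using assms fin by (auto simp: hom_mset_def split: if_splits)
  ultimately show ?thesis unfolding monoms_of_eq by blast
qed

lemma hom_mset_char: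
  assumes size: "size M = n" and set: "set_mset M \<subseteq> {..<n + 1}"
    and sq: "\<And>i. i \<noteq> 0 \<Longrightarrow> count M i \<le> 1"
  shows "M = hom_mset n (set_mset M - {0})"
proof -
  define S where "S = set_mset M - {0}"
  have fin: "finite S" by (simp add: S_def)
  have cnt: "count M i = count (mset_set S) i" if "i \<noteq> 0" for i
    using sq[OF that] that fin count_greater_zero_iff[of M i]
    by (cases "i \<in># M") (simp_all add: S_def not_in_iff del: count_greater_zero_iff)
  have M: "M = replicate_mset (count M 0) 0 + mset_set S"
    by (rule multiset_eqI) (use cnt fin in \<open>auto simp: S_def\<close>)
  have "n = count M 0 + card S"
    using arg_cong[OF M, of size] size by simp
  then show ?thesis using M unfolding hom_mset_def S_def[symmetric] by simp
qed

lemma count_hom_mset: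
  "\<lbrakk>finite S; 0 \<notin> S\<rbrakk> \<Longrightarrow> count (hom_mset n S) i = (if i = 0 then n - card S else if i \<in> S then 1 else 0)"
  by (simp add: hom_mset_def)

lemma mfact_hom_mset:
  assumes "S \<subseteq> {1..n}"
  shows "mfact (n + 1) (hom_mset n S) = fact (n - card S)"
proof -
  have fin: "finite S" "0 \<notin> S" using assms finite_subset by auto
  have "(\<Prod>i\<in>{..<n + 1} - {0}. fact (count (hom_mset n S) i) :: real) = 1"
    by (rule prod.neutral) (simp add: count_hom_mset[OF fin])
  then show ?thesis
    unfolding mfact_def by (subst prod.remove[of _ 0]) (simp_all add: count_hom_mset[OF fin])
qed

text \<open>
  At \<open>p = q = 0\<close> and \<open>t = 1\<close> the weight of \<open>S\<close> is \<open>(n - card S)!\<close> if \<open>S\<close> is a basis of the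
  morphism, and zero otherwise. The factorial cancels the division of \<open>w\<^sub>0\<^sup>k\<close> by \<open>k!\<close> in the
  polynomial of \<open>sq_tensor\<close>.
\<close>
lemma basis_gen_poly_eq_tensor_poly:
  assumes M: "matroid {1..n} r" and N: "matroid {1..m} s" and f: "f ` {1..n} \<subseteq> {1..m}"
  shows "basis_gen_poly n r m s f = tensor_poly (n + 1) n
    (sq_tensor (quotient_weight {1..n} r (\<lambda>S. s (f ` S)) (s {1..m}) 0 0 1))"
    (is "_ = tensor_poly _ _ (sq_tensor ?c)")
proof (rule poly_mapping_eqI)
  fix \<alpha>
  define \<B> where "\<B> = morphism_bases {1..n} r {1..m} s f"
  have B_sub: "S \<subseteq> {1..n}" if "S \<in> \<B>" for S using that by (auto simp: \<B>_def morphism_bases_def)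
  have finB: "finite \<B>" by (rule finite_subset[of _ "Pow {1..n}"]) (use B_sub in auto)
  have c: "?c S = (if S \<in> \<B> then fact (n - card S) else 0)" if S: "S \<subseteq> {1..n}" for S
  proof -
    have "r S \<le> card S" by (rule matroid_rank_le_card[OF M S])
    moreover have "s (f ` S) \<le> s {1..m}" using S f by (intro matroid_mono[OF N]) auto
    ultimately show ?thesis
      using S unfolding \<B>_def morphism_bases_iff[OF M N f] quotient_weight_def
      by (auto simp: power_0_left)
  qed
  have "basis_gen_poly n r m s f = (\<Sum>S\<in>\<B>. Poly_Mapping.single (mon (hom_mset n S)) 1)"
    unfolding basis_gen_poly_def \<B>_def[symmetric] hom_mset_def
    using B_sub finite_subset by (intro sum.cong refl monomial_of_set) blast
  then have lookup: "Poly_Mapping.lookup (basis_gen_poly n r m s f) \<alpha>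
      = (\<Sum>S\<in>\<B>. if mon (hom_mset n S) = \<alpha> then 1 else 0)"
    by (simp add: lookup_sum lookup_single when_def)
  show "Poly_Mapping.lookup (basis_gen_poly n r m s f) \<alpha>
      = Poly_Mapping.lookup (tensor_poly (n + 1) n (sq_tensor ?c)) \<alpha>"
  proof (cases "\<alpha> \<in> monoms_of (n + 1) n")
    case False
    then have "mon (hom_mset n S) \<noteq> \<alpha>" if "S \<in> \<B>" for S
      using hom_mset_monoms_of[OF B_sub[OF that]] by auto
    then show ?thesis unfolding lookup lookup_tensor_poly using False by simp
  next
    case True
    then obtain K where K: "\<alpha> = mon K" "set_mset K \<subseteq> {..<n + 1}" "size K = n"
      unfolding monoms_of_eq by auto
    define S0 where "S0 = set_mset K - {0}"
    have S0: "S0 \<subseteq> {1..n}" using K(2) by (auto simp: S0_def)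
    have rhs: "Poly_Mapping.lookup (tensor_poly (n + 1) n (sq_tensor ?c)) \<alpha>
        = sq_tensor ?c K / mfact (n + 1) K"
      unfolding lookup_tensor_poly using True K by (simp add: mset_of_monom_mon)
    have hom: "set_mset (hom_mset n S) - {0} = S" "\<forall>i. i \<noteq> 0 \<longrightarrow> count (hom_mset n S) i \<le> 1"
      if "S \<in> \<B>" for S
    proof -
      have S: "finite S" "0 \<notin> S" using B_sub[OF that] finite_subset by auto
      then show "set_mset (hom_mset n S) - {0} = S" by (auto simp: hom_mset_def split: if_splits)
      show "\<forall>i. i \<noteq> 0 \<longrightarrow> count (hom_mset n S) i \<le> 1" by (simp add: count_hom_mset[OF S])
    qed
    show ?thesis
    proof (cases "\<forall>i. i \<noteq> 0 \<longrightarrow> count K i \<le> 1")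
      case sq: True
      then have K0: "K = hom_mset n S0"
        unfolding S0_def using K by (intro hom_mset_char) auto
      have "(\<Sum>S\<in>\<B>. if mon (hom_mset n S) = \<alpha> then 1 else 0) = (\<Sum>S\<in>\<B>. if S = S0 then 1 else 0)"
      proof (intro sum.cong refl if_cong)
        show "(mon (hom_mset n S) = \<alpha>) = (S = S0)" if "S \<in> \<B>" for S
          using hom(1)[OF that] K0 K(1) unfolding S0_def by (metis mon_eq_iff)
      qed
      also have "\<dots> = (if S0 \<in> \<B> then 1 else 0)" using finB by simp
      also have "\<dots> = sq_tensor ?c K / mfact (n + 1) K"
      proof -
        have "sq_tensor ?c K = ?c S0" unfolding sq_tensor_def S0_def using sq by simp
        moreover have "mfact (n + 1) K = fact (n - card S0)"
          unfolding K0 by (rule mfact_hom_mset[OF S0])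
        ultimately show ?thesis unfolding c[OF S0] by simp
      qed
      finally show ?thesis unfolding lookup rhs .
    next
      case False
      then have "sq_tensor ?c K = 0" unfolding sq_tensor_def by (simp only: if_False)
      moreover have "mon (hom_mset n S) \<noteq> \<alpha>" if "S \<in> \<B>" for S
        using hom(2)[OF that] False K(1) by (metis mon_eq_iff)
      ultimately show ?thesis unfolding lookup rhs by simp
    qed
  qed
qed

theorem corollary4p6:
  fixes n m :: nat
    and rkM rkN :: "nat set \<Rightarrow> nat"
    and f :: "nat \<Rightarrow> nat"
  assumes "matroid {1..n} rkM"
    and "matroid {1..m} rkN"
    and "matroid_morphism {1..n} rkM {1..m} rkN f"
  shows "lorentzian (n + 1) n (basis_gen_poly n rkM m rkN f)"
proof -
  have f: "f ` {1..n} \<subseteq> {1..m}" using assms(3) unfolding matroid_morphism_def by blast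
  define c where "c = (\<lambda>p t. quotient_weight {1..n} rkM (\<lambda>S. rkN (f ` S)) (rkN {1..m}) p p t)"
  \<comment> \<open>One sequence drives all parameters: \<open>p = q = \<epsilon> = \<delta> k\<close> and \<open>t = 1 - \<delta> k\<close>.\<close>
  define \<delta> :: "nat \<Rightarrow> real" where "\<delta> = (\<lambda>k. 1 / real (k + 2))"
  have \<delta>: "0 < \<delta> k" "\<delta> k < 1" for k by (auto simp: \<delta>_def)
  have \<delta>0: "\<delta> \<longlonglongrightarrow> 0"
    unfolding \<delta>_def by (rule LIMSEQ_ignore_initial_segment[OF lim_1_over_n])
  define T where "T = (\<lambda>k. sq_tensor (c (\<delta> k) (1 - \<delta> k)))"
  define g where "g = (\<lambda>k. tensor_poly (n + 1) n (perturb {..<n + 1} (\<delta> k) (T k)))"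
  have "strictly_lorentzian (n + 1) n (g k)" for k
    unfolding g_def T_def
  proof (rule strictly_lorentzian_perturb[OF _ _ \<delta>(1)])
    show "c (\<delta> k) (1 - \<delta> k) S > 0" for S
      unfolding c_def using \<delta>[of k] by (intro quotient_weight_pos) auto
    show "strictly_locally_log_concave {1..n} (c (\<delta> k) (1 - \<delta> k))"
      unfolding c_def
    proof (rule quotient_weight_log_concave)
      show "matroid_quotient {1..n} rkM (\<lambda>S. rkN (f ` S))" by (rule morphism_quotient[OF assms(3)])
      show "rkM S \<le> card S" if "S \<subseteq> {1..n}" for S using matroid_rank_le_card[OF assms(1) that] .
      show "rkN (f ` {1..n}) \<le> rkN {1..m}" using f by (intro matroid_mono[OF assms(2)]) auto
    qed (use \<delta>[of k] in auto)
  qed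
  moreover have "(\<lambda>k. Poly_Mapping.lookup (g k) \<alpha>)
      \<longlonglongrightarrow> Poly_Mapping.lookup (basis_gen_poly n rkM m rkN f) \<alpha>" for \<alpha>
  proof -
    have "(\<lambda>k. c (\<delta> k) (1 - \<delta> k) S) \<longlonglongrightarrow> c 0 1 S" for S
    proof -
      have "(\<lambda>k. c (\<delta> k) (1 - \<delta> k) S) \<longlonglongrightarrow> c 0 (1 - 0) S"
        unfolding c_def quotient_weight_def by (intro tendsto_intros \<delta>0)
      then show ?thesis by simp
    qed
    moreover have "(\<lambda>k. if Q then x k else 0) \<longlonglongrightarrow> (if Q then y else 0)"
      if "x \<longlonglongrightarrow> y" for Q and x :: "nat \<Rightarrow> real" and y
      using that by (cases Q) auto
    ultimately have T: "(\<lambda>k. T k M) \<longlonglongrightarrow> sq_tensor (c 0 1) M" for M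
      unfolding T_def sq_tensor_def by blast
    have "(\<lambda>k. perturb {..<n + 1} (\<delta> k) (T k) M) \<longlonglongrightarrow> sq_tensor (c 0 1) M"
      if "set_mset M \<subseteq> {..<n + 1}" for M
      by (rule perturb_tendsto[OF _ T \<delta>0 that]) simp
    then have "(\<lambda>k. Poly_Mapping.lookup (g k) \<alpha>)
        \<longlonglongrightarrow> Poly_Mapping.lookup (tensor_poly (n + 1) n (sq_tensor (c 0 1))) \<alpha>"
      unfolding g_def lookup_tensor_poly
      using mfact_pos[of "n + 1" "mset_of_monom (n + 1) \<alpha>"] set_mset_of_monom[of "n + 1" \<alpha>]
      by (auto intro!: tendsto_divide)
    then show ?thesis
      unfolding basis_gen_poly_eq_tensor_poly[OF assms(1,2) f] c_def .
  qed
  moreover have "homogeneous (n + 1) n (basis_gen_poly n rkM m rkN f)"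
    unfolding basis_gen_poly_eq_tensor_poly[OF assms(1,2) f] by (rule homogeneous_tensor_poly)
  ultimately show ?thesis unfolding lorentzian_def by blast
qed

end
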